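(* Let $X$ be a Tychonoff space. The following are equivalent: (1) $B(X)$ is sequentially separable and satisfies $S_{1}(\mathcal{S},\mathcal{S})$; (2) $X$ satisfies $S_{1}(\mathcal{B}_{\Gamma},\mathcal{B}_{\Gamma})$ and $X$ has the $O$-property; (3) $B(X)$ is sequentially separable and satisfies $S_{1}(\Gamma_f,\Gamma_f)$ for every $f\in B(X)$; (4) $B(X)$ is sequentially separable and satisfies $S_{1}(\mathcal{S},\Gamma_f)$ for every $f\in B(X)$; (5) $B(X)$ is sequentially separable and satisfies $S_{fin}(\mathcal{S},\mathcal{S})$; (6) $B(X)$ is sequentially separable and satisfies $U_{fin}(\mathcal{S},\mathcal{S})$; (7) $B(X)$ is sequentially separable and satisfies $S_{fin}(\mathcal{S},\Gamma_f)$ for every $f\in B(X)$; (8) $B(X)$ is sequentially separable and satisfies $U_{fin}(\mathcal{S},\Gamma_f)$ for every $f\in B(X)$.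
   Context: $B(X)$ is the set of all Baire functions on $X$, i.e. the smallest class of functions $X\to\mathbb{R}$ containing all continuous functions and closed under pointwise limits of sequences, with the topology of pointwise convergence (subspace topology from $\mathbb{R}^X$). A Baire set of $X$ is a member of the $\sigma$-algebra generated by the zero-sets of continuous real-valued functions on $X$. Covers are nontrivial: $X$ is not a member of the cover. A $\gamma$-cover is an infinite cover $\mathcal{U}$ such that each $x\in X$ belongs to all but finitely many elements of $\mathcal{U}$. $\mathcal{B}_{\Gamma}$ is the family of countable $\gamma$-covers of $X$ by Baire sets. $X$ has the $O$-property if there is a bijection $\varphi$ from $X$ onto a separable metrizable space $Y$ such that $\varphi^{-1}(U)$ is a Baire set of $X$ for every open $U\subseteq Y$, and $\varphi(T)$ is an $F_\sigma$-set of $Y$ for every Baire set $T$ of $X$. A subset $D$ of a space $Y$ is sequentially dense if every point of $Y$ is the limit of a sequence of points of $D$; $Y$ is sequentially separable if it has a countable sequentially dense subset. $\mathcal{S}$ is the family of countable sequentially dense subsets of $B(X)$. For $f\in B(X)$, $\Gamma_f$ is the family of countably infinite $A\subseteq B(X)$ with $f\notin A$ such that $A\setminus U$ is finite for each neighborhood $U$ of $f$. $S_1(\mathcal{P},\mathcal{Q})$: for each sequence $(A_n)_{n\in\omega}$ of elements of $\mathcal{P}$ there are $b_n\in A_n$ such that $\{b_n:n\in\omega\}\in\mathcal{Q}$. $S_{fin}(\mathcal{P},\mathcal{Q})$: for each sequence $(A_n)_{n\in\omega}$ of elements of $\mathcal{P}$ there are finite sets $B_n\subseteq A_n$ such that $\bigcup_{n\in\omega}B_n\in\mathcal{Q}$.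 $U_{fin}(\mathcal{S},\Gamma_f)$: for each sequence $(S_n)_{n\in\omega}$ of elements of $\mathcal{S}$ there are finite $F_n\subseteq S_n$ such that for every finite $K\subseteq X$ and every $\epsilon>0$ there is $n'\in\omega$ such that for each $n>n'$ and each $x\in K$ there is $g\in F_n$ with $|g(x)-f(x)|<\epsilon$. $U_{fin}(\mathcal{S},\mathcal{S})$: for each sequence $(S_n)_{n\in\omega}$ of elements of $\mathcal{S}$ there are finite $F_n\subseteq S_n$ such that for every $f\in B(X)$, every finite $K\subseteq X$ and every $\epsilon>0$ there is $n'\in\omega$ such that for each $n>n'$ and each $x\in K$ there is $g\in F_n$ with $|g(x)-f(x)|<\epsilon$. *)

theory Defs
  imports "HOL-Analysis.Analysis"
begin

definition tychonoff_space :: "'a topology \<Rightarrow> bool" where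
  "tychonoff_space X \<longleftrightarrow> completely_regular_space X \<and> Hausdorff_space X"

definition all_equivalent :: "bool list \<Rightarrow> bool" where
  "all_equivalent Ps \<longleftrightarrow> (\<forall>P\<in>set Ps. \<forall>Q\<in>set Ps. P \<longleftrightarrow> Q)"


subsection \<open>Baire sets and Baire functions\<close>

definition zero_sets :: "'a topology \<Rightarrow> 'a set set" where
  "zero_sets X = {{x \<in> topspace X. f x = (0::real)} | f. continuous_map X euclideanreal f}"

definition baire_sets :: "'a topology \<Rightarrow> 'a set set" where
  "baire_sets X = sigma_sets (topspace X) (zero_sets X)"

text \<open>A real-valued function on the space \<open>X\<close> is represented by its unique extension to the
  whole type that is \<open>undefined\<close> outside \<open>topspace X\<close>; this is the convention of
  \<^const>\<open>product_topology\<close>, so these functions are exactly the points of the power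
  of the real line with index set \<open>topspace X\<close>.\<close>

inductive_set baire_functions :: "'a topology \<Rightarrow> ('a \<Rightarrow> real) set" for X :: "'a topology" where
  continuous: "f \<in> extensional (topspace X) \<Longrightarrow> continuous_map X euclideanreal f
    \<Longrightarrow> f \<in> baire_functions X"
| limit: "(\<And>n::nat. F n \<in> baire_functions X) \<Longrightarrow> f \<in> extensional (topspace X)
    \<Longrightarrow> (\<And>x. x \<in> topspace X \<Longrightarrow> (\<lambda>n. F n x) \<longlonglongrightarrow> f x) \<Longrightarrow> f \<in> baire_functions X"

definition baire_function_space :: "'a topology \<Rightarrow> ('a \<Rightarrow> real) topology" where
  "baire_function_space X =
     subtopology (product_topology (\<lambda>_. euclideanreal) (topspace X)) (baire_functions X)"


subsection \<open>Sequential density\<close>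

definition sequentially_dense_in :: "'b topology \<Rightarrow> 'b set \<Rightarrow> bool" where
  "sequentially_dense_in Y D \<longleftrightarrow> D \<subseteq> topspace Y \<and>
     (\<forall>y\<in>topspace Y. \<exists>s::nat \<Rightarrow> 'b. range s \<subseteq> D \<and> limitin Y s y sequentially)"

definition sequentially_separable_space :: "'b topology \<Rightarrow> bool" where
  "sequentially_separable_space Y \<longleftrightarrow> (\<exists>D. countable D \<and> sequentially_dense_in Y D)"


subsection \<open>Covers and families of functions\<close>

text \<open>Covers are nontrivial: the whole space is not a member.\<close>

definition gamma_cover :: "'a topology \<Rightarrow> 'a set set \<Rightarrow> bool" where
  "gamma_cover X \<U> \<longleftrightarrow> \<Union>\<U> = topspace X \<and> topspace X \<notin> \<U> \<and> infinite \<U> \<and>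
     (\<forall>x\<in>topspace X. finite {U \<in> \<U>. x \<notin> U})"

definition baire_gamma_covers :: "'a topology \<Rightarrow> 'a set set set" where
  "baire_gamma_covers X = {\<U>. countable \<U> \<and> gamma_cover X \<U> \<and> \<U> \<subseteq> baire_sets X}"

definition countable_seq_dense_families :: "'a topology \<Rightarrow> ('a \<Rightarrow> real) set set" where
  "countable_seq_dense_families X =
     {D. countable D \<and> sequentially_dense_in (baire_function_space X) D}"

definition gamma_families_at :: "'a topology \<Rightarrow> ('a \<Rightarrow> real) \<Rightarrow> ('a \<Rightarrow> real) set set" where
  "gamma_families_at X f =
     {A. A \<subseteq> baire_functions X \<and> countable A \<and> infinite A \<and> f \<notin> A \<and>
         (\<forall>U. openin (baire_function_space X) U \<and> f \<in> U \<longrightarrow> finite (A - U))}"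


subsection \<open>The O-property\<close>

text \<open>The space \<open>Y\<close> is in bijection with \<open>X\<close>, so up to homeomorphism its points may be taken
  from the type of the points of \<open>X\<close>.\<close>

definition O_property :: "'a topology \<Rightarrow> bool" where
  "O_property X \<longleftrightarrow>
     (\<exists>(Y::'a topology) \<phi>. metrizable_space Y \<and> separable_space Y \<and>
        bij_betw \<phi> (topspace X) (topspace Y) \<and>
        (\<forall>U. openin Y U \<longrightarrow> {x \<in> topspace X. \<phi> x \<in> U} \<in> baire_sets X) \<and>
        (\<forall>T\<in>baire_sets X. fsigma_in Y (\<phi> ` T)))"


subsection \<open>Selection principles\<close>

definition S_one :: "'b set set \<Rightarrow> 'b set set \<Rightarrow> bool" where
  "S_one P Q \<longleftrightarrow> (\<forall>A::nat \<Rightarrow> 'b set. (\<forall>n. A n \<in> P) \<longrightarrow>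
     (\<exists>b. (\<forall>n. b n \<in> A n) \<and> range b \<in> Q))"

definition S_fin :: "'b set set \<Rightarrow> 'b set set \<Rightarrow> bool" where
  "S_fin P Q \<longleftrightarrow> (\<forall>A::nat \<Rightarrow> 'b set. (\<forall>n. A n \<in> P) \<longrightarrow>
     (\<exists>B. (\<forall>n. finite (B n) \<and> B n \<subseteq> A n) \<and> (\<Union>n. B n) \<in> Q))"

definition eventually_approximates ::
    "'a topology \<Rightarrow> (nat \<Rightarrow> ('a \<Rightarrow> real) set) \<Rightarrow> ('a \<Rightarrow> real) \<Rightarrow> bool" where
  "eventually_approximates X F f \<longleftrightarrow>
     (\<forall>K \<epsilon>. finite K \<and> K \<subseteq> topspace X \<and> \<epsilon> > 0 \<longrightarrow>
        (\<exists>n'. \<forall>n>n'. \<forall>x\<in>K. \<exists>g\<in>F n. \<bar>g x - f x\<bar> < \<epsilon>))"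

definition U_fin_dense_gamma :: "'a topology \<Rightarrow> ('a \<Rightarrow> real) \<Rightarrow> bool" where
  "U_fin_dense_gamma X f \<longleftrightarrow>
     (\<forall>S::nat \<Rightarrow> ('a \<Rightarrow> real) set. (\<forall>n. S n \<in> countable_seq_dense_families X) \<longrightarrow>
        (\<exists>F. (\<forall>n. finite (F n) \<and> F n \<subseteq> S n) \<and> eventually_approximates X F f))"

definition U_fin_dense_dense :: "'a topology \<Rightarrow> bool" where
  "U_fin_dense_dense X \<longleftrightarrow>
     (\<forall>S::nat \<Rightarrow> ('a \<Rightarrow> real) set. (\<forall>n. S n \<in> countable_seq_dense_families X) \<longrightarrow>
        (\<exists>F. (\<forall>n. finite (F n) \<and> F n \<subseteq> S n) \<and>
             (\<forall>f\<in>baire_functions X. eventually_approximates X F f)))"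

end

theory Submission
  imports Defs
begin

text \<open>
  The Baire functions on \<open>X\<close> are the real functions that are measurable for the
  \<open>\<sigma>\<close>-algebra of Baire sets (\<open>baire_functions_eq\<close>), so that functions can be altered on Baire
  sets and sets defined by Baire functions are Baire.

  The selection property of covers by Baire sets says that, for Baire sets \<open>U k m\<close> such that for
  each \<open>k\<close> every point is in \<open>U k m\<close> for almost all \<open>m\<close>, there are indices \<open>m k\<close> such that every
  point is in \<open>U k (m k)\<close> for almost all \<open>k\<close> (\<open>baire_index_selection\<close>). Applied to the sets on
  which the \<open>m\<close>-th term of the \<open>k\<close>-th of given convergent sequences is within \<open>1/(k+1)\<close> of
  its limit, this yields a diagonal property of \<open>B(X)\<close> (\<open>baire_diagonal\<close>): from countably many
  convergent sequences one can choose one term each such that the distances to the respective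
  limits tend to \<open>0\<close>. All the selection principles in \<open>B(X)\<close> follow from it by choosing
  the convergent sequences well.

  Conversely, each selection principle allows one to choose finite subsets of given countable
  sequentially dense sets that approximate a given function outside these sets along a sequence
  of indices (\<open>dense_approximation\<close>). This implies the selection of indices
  (\<open>dense_approximation_imp_baire_index_selection\<close>). Let \<open>V k m\<close> be the set of points that are
  in \<open>U i m'\<close> for all \<open>i \<le> k\<close> and \<open>m' \<ge> m\<close>, and let \<open>d\<^sub>0, d\<^sub>1, \<dots>\<close> list a
  countable sequentially dense set with infinitely many repetitions. The functions \<open>d' k m\<close>
  that equal \<open>d\<^sub>m\<close> on \<open>V k m\<close> and \<open>1\<close> elsewhere form, for each \<open>k\<close>, a sequentially dense set. If
  finitely many of them approximate a constant \<open>c \<noteq> 1\<close> at \<open>x\<close>, then \<open>x\<close> is in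
  \<open>V k m\<close>, hence in \<open>U k m\<close>, for the largest index \<open>m\<close> that occurs among them. As \<open>V k m\<close> decreases
  in \<open>k\<close>, this also serves all smaller \<open>k\<close>, so that approximation along a sequence of indices
  suffices.

  Sequential separability of \<open>B(X)\<close> gives the O-property, because the functions of a countable
  sequentially dense set embed \<open>X\<close> into the metrizable space of real sequences. In the other
  direction, the O-property makes the \<open>\<sigma>\<close>-algebra of Baire sets countably generated. By the
  diagonal property the sequential closure of the countable set of rational combinations of
  indicators of generating sets is closed under limits of sequences, hence contains all Baire
  functions by a monotone class argument.\<close>


section \<open>Baire functions are the Baire measurable functions\<close>

definition baire_measurable_space :: "'a topology \<Rightarrow> 'a measure" where
  "baire_measurable_space X = sigma (topspace X) (zero_sets X)"

lemma zero_sets_iff: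
  "A \<in> zero_sets X \<longleftrightarrow>
     (\<exists>f. A = {x \<in> topspace X. f x = (0::real)} \<and> continuous_map X euclideanreal f)"
  by (simp only: zero_sets_def mem_Collect_eq)

lemma zero_setI:
  "continuous_map X euclideanreal f \<Longrightarrow> {x \<in> topspace X. f x = (0::real)} \<in> zero_sets X"
  unfolding zero_sets_iff by (rule exI[of _ f]) simp

lemma zero_sets_Pow: "zero_sets X \<subseteq> Pow (topspace X)"
  by (auto simp: zero_sets_def)

lemma space_baire_measurable_space [simp]: "space (baire_measurable_space X) = topspace X"
  using zero_sets_Pow[of X] by (simp add: baire_measurable_space_def)

lemma sets_baire_measurable_space: "sets (baire_measurable_space X) = baire_sets X"
  using zero_sets_Pow[of X] by (simp add: baire_measurable_space_def baire_sets_def)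

text \<open>Two classes of functions have to be shown to contain all measurable functions: the Baire
  functions, and later the sequential closure of a countable set. In both cases only linearity
  and closure under pointwise limits are at hand, not closure under products, which is why the
  generator has to be closed under intersections and the Dynkin form of the
  \<open>\<sigma>\<close>-algebra induction is used.\<close>

lemma functional_monotone_class:
  fixes C :: "('a \<Rightarrow> real) set"
  assumes G: "Int_stable G" "G \<subseteq> Pow \<Omega>" "\<Omega> \<in> G"
    and ind: "\<And>A. A \<in> G \<Longrightarrow> restrict (indicator A) \<Omega> \<in> C"
    and add: "\<And>f g. f \<in> C \<Longrightarrow> g \<in> C \<Longrightarrow> (\<lambda>x\<in>\<Omega>. f x + g x) \<in> C"
    and scale: "\<And>c f. f \<in> C \<Longrightarrow> (\<lambda>x\<in>\<Omega>. c * f x) \<in> C"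
    and lim: "\<And>F f. (\<And>n::nat. F n \<in> C) \<Longrightarrow> f \<in> extensional \<Omega> \<Longrightarrow>
      (\<And>x. x \<in> \<Omega> \<Longrightarrow> (\<lambda>n. F n x) \<longlonglongrightarrow> f x) \<Longrightarrow> f \<in> C"
    and f: "f \<in> extensional \<Omega>" "f \<in> borel_measurable (sigma \<Omega> G)"
  shows "f \<in> C"
proof -
  have one: "(\<lambda>x\<in>\<Omega>. 1) \<in> C"
  proof -
    have "(\<lambda>x\<in>\<Omega>. 1) = restrict (indicator \<Omega> :: 'a \<Rightarrow> real) \<Omega>"
      by (auto simp: restrict_def)
    then show ?thesis
      using ind[OF G(3)] by simp
  qed
  have zero: "(\<lambda>x\<in>\<Omega>. 0) \<in> C"
  proof -
    have "(\<lambda>x\<in>\<Omega>. 0 * (\<lambda>x\<in>\<Omega>. 1) x) \<in> C"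
      by (rule scale[OF one])
    also have "(\<lambda>x\<in>\<Omega>. 0 * (\<lambda>x\<in>\<Omega>. 1) x) = (\<lambda>x\<in>\<Omega>. 0 :: real)"
      by auto
    finally show ?thesis .
  qed
  have sum: "(\<lambda>x\<in>\<Omega>. \<Sum>i\<in>I. h i x) \<in> C"
    if "finite I" "\<And>i. i \<in> I \<Longrightarrow> restrict (h i) \<Omega> \<in> C" for I :: "'i set" and h
    using that
  proof (induction I rule: finite_induct)
    case (insert i I)
    have "(\<lambda>x\<in>\<Omega>. restrict (h i) \<Omega> x + (\<lambda>x\<in>\<Omega>. \<Sum>i\<in>I. h i x) x) \<in> C"
      by (intro add insert) auto
    also have "(\<lambda>x\<in>\<Omega>. restrict (h i) \<Omega> x + (\<lambda>x\<in>\<Omega>. \<Sum>i\<in>I. h i x) x) =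
        (\<lambda>x\<in>\<Omega>. \<Sum>i\<in>insert i I. h i x)"
      using insert by (auto simp: restrict_def)
    finally show ?case .
  qed (simp add: zero)
  have indicator: "restrict (indicator A) \<Omega> \<in> C" if "A \<in> sigma_sets \<Omega> G" for A
    using G(1,2) that
  proof (induction rule: sigma_sets_induct_disjoint)
    case empty
    have "restrict (indicator {} :: 'a \<Rightarrow> real) \<Omega> = (\<lambda>x\<in>\<Omega>. 0)"
      by (auto simp: restrict_def)
    then show ?case
      by (simp only: zero)
  next
    case (compl A)
    have "(\<lambda>x\<in>\<Omega>. (\<lambda>x\<in>\<Omega>. 1) x + (\<lambda>x\<in>\<Omega>. - 1 * restrict (indicator A) \<Omega> x) x) \<in> C"
      using compl by (intro add one scale)
    also have "(\<lambda>x\<in>\<Omega>. (\<lambda>x\<in>\<Omega>. 1) x + (\<lambda>x\<in>\<Omega>. - 1 * restrict (indicator A) \<Omega> x) x) =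
        restrict (indicator (\<Omega> - A) :: 'a \<Rightarrow> real) \<Omega>"
      by (auto simp: restrict_def fun_eq_iff indicator_def)
    finally show ?case .
  next
    case (union A)
    show ?case
    proof (rule lim)
      show "(\<lambda>x\<in>\<Omega>. \<Sum>i<n. indicat_real (A i) x) \<in> C" for n :: nat
        by (intro sum finite_lessThan union)
      show "(\<lambda>n. (\<lambda>x\<in>\<Omega>. \<Sum>i<n. indicat_real (A i) x) x) \<longlonglongrightarrow> restrict (indicat_real (\<Union>i. A i)) \<Omega> x"
        if "x \<in> \<Omega>" for x
        using indicator_sums[of A x] union(1) that by (simp add: sums_def disjoint_family_on_def)
    qed (rule restrict_extensional)
  qed (rule ind)
  let ?M = "sigma \<Omega> G"
  have space: "space ?M = \<Omega>" and sets: "sets ?M = sigma_sets \<Omega> G"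
    using G by auto
  obtain F where F: "\<And>i. simple_function ?M (F i)"
    and F_lim: "\<And>x. x \<in> \<Omega> \<Longrightarrow> (\<lambda>i. F i x) \<longlonglongrightarrow> f x"
    using borel_measurable_implies_sequence_metric[OF f(2), of 0] space by auto
  show "f \<in> C"
  proof (rule lim)
    show "restrict (F n) \<Omega> \<in> C" for n
    proof -
      have "(\<lambda>x\<in>\<Omega>. \<Sum>y\<in>F n ` \<Omega>. y * indicator (F n -` {y} \<inter> \<Omega>) x) \<in> C"
      proof (rule sum)
        show "finite (F n ` \<Omega>)"
          using simple_functionD(1)[OF F] space by auto
        fix y
        assume "y \<in> F n ` \<Omega>"
        then have "F n -` {y} \<inter> \<Omega> \<in> sigma_sets \<Omega> G"
          using simple_functionD(2)[OF F] space sets by metis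
        then have "(\<lambda>x\<in>\<Omega>. y * restrict (indicator (F n -` {y} \<inter> \<Omega>)) \<Omega> x) \<in> C"
          by (intro scale indicator)
        also have "(\<lambda>x\<in>\<Omega>. y * restrict (indicator (F n -` {y} \<inter> \<Omega>)) \<Omega> x) =
            (\<lambda>x\<in>\<Omega>. y * indicator (F n -` {y} \<inter> \<Omega>) x)"
          by (auto simp: restrict_def)
        finally show "(\<lambda>x\<in>\<Omega>. y * indicator (F n -` {y} \<inter> \<Omega>) x) \<in> C" .
      qed
      also have "(\<lambda>x\<in>\<Omega>. \<Sum>y\<in>F n ` \<Omega>. y * indicator (F n -` {y} \<inter> \<Omega>) x) = restrict (F n) \<Omega>"
      proof (rule restrict_ext)
        fix x
        assume x: "x \<in> \<Omega>"
        have "(\<Sum>y\<in>F n ` \<Omega>. y * indicator (F n -` {y} \<inter> \<Omega>) x) =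
            (\<Sum>y\<in>F n ` \<Omega>. if y = F n x then F n x else 0)"
          using x by (intro sum.cong) (auto simp: indicator_def)
        also have "\<dots> = F n x"
          using x simple_functionD(1)[OF F, of n] space by simp
        finally show "(\<Sum>y\<in>F n ` \<Omega>. y * indicator (F n -` {y} \<inter> \<Omega>) x) = F n x" .
      qed
      finally show ?thesis .
    qed
  qed (use f F_lim in auto)
qed

lemma zero_sets_Int_stable: "Int_stable (zero_sets X)"
proof (rule Int_stableI)
  fix A B
  assume A: "A \<in> zero_sets X" and B: "B \<in> zero_sets X"
  obtain f where f: "A = {x \<in> topspace X. f x = 0}" "continuous_map X euclideanreal f"
    using A unfolding zero_sets_iff by (elim exE conjE)
  obtain g where g: "B = {x \<in> topspace X. g x = 0}" "continuous_map X euclideanreal g"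
    using B unfolding zero_sets_iff by (elim exE conjE)
  have cont: "continuous_map X euclideanreal (\<lambda>x. \<bar>f x\<bar> + \<bar>g x\<bar>)"
    using f(2) g(2) by (intro continuous_map_add continuous_map_real_abs)
  have "A \<inter> B = {x \<in> topspace X. \<bar>f x\<bar> + \<bar>g x\<bar> = 0}"
    unfolding f(1) g(1) by auto
  then show "A \<inter> B \<in> zero_sets X"
    using zero_setI[OF cont] by simp
qed

lemma topspace_in_zero_sets: "topspace X \<in> zero_sets X"
  using zero_setI[of X "\<lambda>_. 0"] by simp

lemma continuous_map_baire_measurable:
  assumes "continuous_map X euclideanreal f"
  shows "f \<in> borel_measurable (baire_measurable_space X)"
proof (rule borel_measurableI_ge)
  fix y
  have cont: "continuous_map X euclideanreal (\<lambda>x. max 0 (y - f x))"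
    using assms by (intro continuous_map_real_max continuous_map_diff continuous_map_canonical_const)
  have "{x \<in> topspace X. y \<le> f x} = {x \<in> topspace X. max 0 (y - f x) = 0}"
    by auto
  then have "{x \<in> topspace X. y \<le> f x} \<in> zero_sets X"
    using zero_setI[OF cont] by simp
  then show "{x \<in> space (baire_measurable_space X). y \<le> f x} \<in> sets (baire_measurable_space X)"
    by (auto simp: sets_baire_measurable_space baire_sets_def)
qed

lemma restrict_continuous_in_baire_functions:
  assumes "continuous_map X euclideanreal f"
  shows "restrict f (topspace X) \<in> baire_functions X"
proof (rule baire_functions.continuous)
  show "continuous_map X euclideanreal (restrict f (topspace X))"
    using assms by (rule continuous_map_eq) simp
qed (rule restrict_extensional)

lemma baire_functions_add:
  assumes "f \<in> baire_functions X" "g \<in> baire_functions X"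
  shows "(\<lambda>x\<in>topspace X. f x + g x) \<in> baire_functions X"
  using assms
proof (induction arbitrary: g)
  case f: (continuous f)
  show ?case
    using f.prems
  proof induction
    case (continuous g)
    show ?case
      by (intro restrict_continuous_in_baire_functions continuous_map_add f continuous)
  next
    case (limit G g)
    show ?case
    proof (rule baire_functions.limit)
      show "(\<lambda>x\<in>topspace X. f x + G n x) \<in> baire_functions X" for n
        by (rule limit.IH)
      show "(\<lambda>n. (\<lambda>x\<in>topspace X. f x + G n x) x) \<longlonglongrightarrow> (\<lambda>x\<in>topspace X. f x + g x) x"
        if "x \<in> topspace X" for x
        using tendsto_add[OF tendsto_const limit.hyps(3)[OF that]] that by simp
    qed (rule restrict_extensional)
  qed
next
  case (limit F f)
  show ?case
  proof (rule baire_functions.limit)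
    show "(\<lambda>x\<in>topspace X. F n x + g x) \<in> baire_functions X" for n
      by (rule limit.IH[OF limit.prems])
    show "(\<lambda>n. (\<lambda>x\<in>topspace X. F n x + g x) x) \<longlonglongrightarrow> (\<lambda>x\<in>topspace X. f x + g x) x"
      if "x \<in> topspace X" for x
      using tendsto_add[OF limit.hyps(3)[OF that] tendsto_const] that by simp
  qed (rule restrict_extensional)
qed

lemma baire_functions_scale:
  assumes "f \<in> baire_functions X"
  shows "(\<lambda>x\<in>topspace X. c * f x) \<in> baire_functions X"
  using assms
proof induction
  case (continuous f)
  show ?case
    by (intro restrict_continuous_in_baire_functions continuous_map_real_mult_left continuous)
next
  case (limit F f)
  show ?case
  proof (rule baire_functions.limit)
    show "(\<lambda>x\<in>topspace X. c * F n x) \<in> baire_functions X" for n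
      by (rule limit.IH)
    show "(\<lambda>n. (\<lambda>x\<in>topspace X. c * F n x) x) \<longlonglongrightarrow> (\<lambda>x\<in>topspace X. c * f x) x"
      if "x \<in> topspace X" for x
      using tendsto_mult_left[OF limit.hyps(3)[OF that]] that by simp
  qed (rule restrict_extensional)
qed

lemma borel_measurable_restrict_iff:
  "restrict f (space M) \<in> borel_measurable M \<longleftrightarrow> f \<in> borel_measurable M"
  by (rule measurable_cong) auto

theorem baire_functions_eq:
  "baire_functions X =
     {f \<in> extensional (topspace X). f \<in> borel_measurable (baire_measurable_space X)}"
proof safe
  fix f
  assume "f \<in> baire_functions X"
  then show "f \<in> extensional (topspace X)"
    by cases
next
  fix f
  assume "f \<in> baire_functions X"
  then show "f \<in> borel_measurable (baire_measurable_space X)"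
  proof induction
    case (limit F f)
    show ?case
      by (rule borel_measurable_LIMSEQ_real[where u = F])
        (simp_all only: space_baire_measurable_space limit)
  qed (rule continuous_map_baire_measurable)
next
  fix f :: "'a \<Rightarrow> real"
  assume f: "f \<in> extensional (topspace X)" "f \<in> borel_measurable (baire_measurable_space X)"
  show "f \<in> baire_functions X"
  proof (rule functional_monotone_class[OF zero_sets_Int_stable zero_sets_Pow topspace_in_zero_sets])
    show "restrict (indicator A) (topspace X) \<in> baire_functions X"
      if A: "A \<in> zero_sets X" for A
    proof -
      obtain g where g: "A = {x \<in> topspace X. g x = 0}" "continuous_map X euclideanreal g"
        using A unfolding zero_sets_iff by (elim exE conjE)
      \<comment> \<open>These continuous functions decrease to the indicator of the zero set of \<open>g\<close>.\<close>
      define F where "F n = (\<lambda>x\<in>topspace X. max 0 (1 - real n * \<bar>g x\<bar>))" for n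
      have cont: "continuous_map X euclideanreal (\<lambda>x. max 0 (1 - real n * \<bar>g x\<bar>))" for n
        using g by (intro continuous_map_real_max continuous_map_diff continuous_map_real_mult
          continuous_map_canonical_const continuous_map_real_abs)
      show ?thesis
      proof (rule baire_functions.limit)
        show "F n \<in> baire_functions X" for n
          unfolding F_def by (intro restrict_continuous_in_baire_functions cont)
        fix x
        assume x: "x \<in> topspace X"
        show "(\<lambda>n. F n x) \<longlonglongrightarrow> restrict (indicator A) (topspace X) x"
        proof (cases "g x = 0")
          case True
          then show ?thesis
            using x g by (simp add: F_def)
        next
          case False
          obtain N where N: "1 < real N * \<bar>g x\<bar>"
            using False reals_Archimedean3[of "\<bar>g x\<bar>"] by auto
          have "F n x = 0" if "n \<ge> N" for n
          proof -
            have "real N * \<bar>g x\<bar> \<le> real n * \<bar>g x\<bar>"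
              using that by (intro mult_right_mono) auto
            then show ?thesis
              using N x by (simp add: F_def)
          qed
          then have "eventually (\<lambda>n. F n x = 0) sequentially"
            by (auto simp: eventually_sequentially)
          then show ?thesis
            using x g False by (simp add: tendsto_eventually)
        qed
      qed (rule restrict_extensional)
    qed
    show "f \<in> borel_measurable (sigma (topspace X) (zero_sets X))"
      using f by (simp add: baire_measurable_space_def)
  qed (fact baire_functions_add baire_functions_scale baire_functions.limit f(1))+
qed

lemma restrict_in_baire_functions_iff:
  "restrict f (topspace X) \<in> baire_functions X \<longleftrightarrow> f \<in> borel_measurable (baire_measurable_space X)"
  using borel_measurable_restrict_iff[of f "baire_measurable_space X"]
  by (simp add: baire_functions_eq)

lemma baire_functions_measurable:
  "f \<in> baire_functions X \<Longrightarrow> f \<in> borel_measurable (baire_measurable_space X)"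
  by (simp add: baire_functions_eq)

lemma baire_functions_eqI:
  assumes "f \<in> baire_functions X" "g \<in> baire_functions X"
    and "\<And>x. x \<in> topspace X \<Longrightarrow> f x = g x"
  shows "f = g"
  using assms by (auto simp: baire_functions_eq intro: extensionalityI)


section \<open>Pointwise convergence and the families of functions\<close>

definition converges_pointwise ::
    "'a topology \<Rightarrow> (nat \<Rightarrow> 'a \<Rightarrow> real) \<Rightarrow> ('a \<Rightarrow> real) \<Rightarrow> bool" where
  "converges_pointwise X s f \<longleftrightarrow> (\<forall>x\<in>topspace X. (\<lambda>n. s n x) \<longlonglongrightarrow> f x)"

lemma converges_pointwise_subseq:
  assumes "converges_pointwise X s f" "filterlim r at_top sequentially"
  shows "converges_pointwise X (\<lambda>n. s (r n)) f"
  using assms by (auto simp: converges_pointwise_def intro: filterlim_compose)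

lemma topspace_baire_function_space: "topspace (baire_function_space X) = baire_functions X"
proof -
  have "baire_functions X \<subseteq> extensional (topspace X)"
    unfolding baire_functions_eq by (rule Collect_restrict)
  then show ?thesis
    unfolding baire_function_space_def topspace_subtopology topspace_product_topology_alt by auto
qed

lemma limitin_baire_function_space:
  assumes "\<And>n. s n \<in> baire_functions X"
  shows "limitin (baire_function_space X) s f sequentially \<longleftrightarrow>
    f \<in> baire_functions X \<and> converges_pointwise X s f"
  using assms
  by (auto simp: baire_function_space_def limitin_subtopology limitin_componentwise
      converges_pointwise_def baire_functions_eq PiE_iff)

lemma countable_seq_dense_families_iff:
  "D \<in> countable_seq_dense_families X \<longleftrightarrow> countable D \<and> D \<subseteq> baire_functions X \<and>
     (\<forall>f\<in>baire_functions X. \<exists>s. range s \<subseteq> D \<and> converges_pointwise X s f)"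
proof -
  have "range s \<subseteq> D \<and> limitin (baire_function_space X) s f sequentially \<longleftrightarrow>
      range s \<subseteq> D \<and> converges_pointwise X s f"
    if "D \<subseteq> baire_functions X" "f \<in> baire_functions X" for s f
    using that limitin_baire_function_space[of s X f] by blast
  then show ?thesis
    unfolding countable_seq_dense_families_def sequentially_dense_in_def topspace_baire_function_space
    by (simp cong: conj_cong)
qed

lemma sequentially_separable_iff:
  "sequentially_separable_space (baire_function_space X) \<longleftrightarrow> countable_seq_dense_families X \<noteq> {}"
  by (auto simp: sequentially_separable_space_def countable_seq_dense_families_def)

lemma openin_baire_function_space_pointwise:
  assumes "x \<in> topspace X"
  shows "openin (baire_function_space X) {g \<in> baire_functions X. \<bar>g x - c\<bar> < e}"
proof -
  have "continuous_map (baire_function_space X) euclideanreal (\<lambda>g. g x)"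
    unfolding baire_function_space_def
    using assms by (intro continuous_map_from_subtopology continuous_map_product_projection)
  moreover have "openin euclideanreal {y. \<bar>y - c\<bar> < e}"
    by (auto intro!: open_Collect_less continuous_intros)
  ultimately have "openin (baire_function_space X)
      {g \<in> topspace (baire_function_space X). g x \<in> {y. \<bar>y - c\<bar> < e}}"
    by (rule openin_continuous_map_preimage)
  then show ?thesis
    by (simp add: topspace_baire_function_space)
qed

lemma gamma_family_converges:
  assumes A: "A \<in> gamma_families_at X f" and f: "f \<in> baire_functions X"
    and s: "inj s" "range s \<subseteq> A"
  shows "converges_pointwise X s f"
  unfolding converges_pointwise_def
proof
  fix x
  assume x: "x \<in> topspace X"
  show "(\<lambda>n. s n x) \<longlonglongrightarrow> f x"
  proof (rule tendstoI)
    fix e :: real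
    assume e: "e > 0"
    define U where "U = {g \<in> baire_functions X. \<bar>g x - f x\<bar> < e}"
    have "openin (baire_function_space X) U" "f \<in> U"
      using openin_baire_function_space_pointwise[OF x] f e by (auto simp: U_def)
    then have "finite (A - U)"
      using A by (auto simp: gamma_families_at_def)
    then have "finite (s -` (A - U))"
      using s(1) by (intro finite_vimageI)
    moreover have "{n. \<not> dist (s n x) (f x) < e} \<subseteq> s -` (A - U)"
      using s(2) by (auto simp: U_def dist_real_def)
    ultimately have "finite {n. \<not> dist (s n x) (f x) < e}"
      by (rule finite_subset[rotated])
    then show "\<forall>\<^sub>F n in sequentially. dist (s n x) (f x) < e"
      by (simp add: cofinite_eq_sequentially[symmetric] eventually_cofinite)
  qed
qed

lemma recurrent_value_eq_limit:
  assumes g: "g \<in> baire_functions X" and f: "f \<in> baire_functions X" "converges_pointwise X s f"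
    and freq: "\<exists>\<^sub>F n in sequentially. s n = g"
  shows "g = f"
proof (rule baire_functions_eqI[OF g f(1)])
  fix x
  assume "x \<in> topspace X"
  then have lim: "(\<lambda>n. s n x) \<longlonglongrightarrow> f x"
    using f(2) by (auto simp: converges_pointwise_def)
  show "g x = f x"
  proof (rule ccontr)
    assume "g x \<noteq> f x"
    then have "\<forall>\<^sub>F n in sequentially. s n x \<noteq> g x"
      using tendsto_imp_eventually_ne[OF lim] by metis
    with freq have "\<exists>\<^sub>F n in sequentially. s n x \<noteq> g x \<and> s n = g"
      by (rule frequently_eventually_conj)
    then show False
      by (auto dest!: frequently_ex)
  qed
qed

lemma range_gamma_family:
  assumes s: "\<And>n. s n \<in> baire_functions X" "\<And>n. s n \<noteq> f"
    and f: "f \<in> baire_functions X" "converges_pointwise X s f"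
  shows "range s \<in> gamma_families_at X f"
proof -
  have "infinite (range s)"
  proof
    assume "finite (range s)"
    then obtain k where "infinite {n \<in> UNIV. s n = s k}"
      using pigeonhole_infinite[of UNIV s] by auto
    then have freq: "\<exists>\<^sub>F n in sequentially. s n = s k"
      by (simp add: cofinite_eq_sequentially[symmetric] frequently_cofinite)
    have "s k = f"
      by (rule recurrent_value_eq_limit[OF s(1) f freq])
    then show False
      using s(2) by blast
  qed
  moreover have "finite (range s - U)" if U: "openin (baire_function_space X) U" "f \<in> U" for U
  proof -
    have "limitin (baire_function_space X) s f sequentially"
      using limitin_baire_function_space[of s X f] s(1) f by blast
    then obtain N where "\<And>n. n \<ge> N \<Longrightarrow> s n \<in> U"
      using U by (auto simp: limitin_def eventually_sequentially)
    then have "range s - U \<subseteq> s ` {..<N}"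
      by (auto simp: image_iff) (metis lessThan_iff not_le)
    then show ?thesis
      by (rule finite_subset) simp
  qed
  ultimately show ?thesis
    using s by (auto simp: gamma_families_at_def)
qed


section \<open>The covering property as a selection of indices\<close>

text \<open>Working with indexed sequences of sets, in which repetitions and the whole space are
  allowed, removes the requirements of infinity and nontriviality from the covering property.\<close>

definition baire_index_selection :: "'a topology \<Rightarrow> bool" where
  "baire_index_selection X \<longleftrightarrow>
     (\<forall>U::nat \<Rightarrow> nat \<Rightarrow> 'a set. (\<forall>k m. U k m \<in> baire_sets X) \<and>
        (\<forall>k. \<forall>x\<in>topspace X. \<forall>\<^sub>F m in sequentially. x \<in> U k m) \<longrightarrow>
        (\<exists>m. \<forall>x\<in>topspace X. \<forall>\<^sub>F k in sequentially. x \<in> U k (m k)))"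

lemma baire_sets_subset: "A \<in> baire_sets X \<Longrightarrow> A \<subseteq> topspace X"
  using sets.sets_into_space[of A "baire_measurable_space X"]
  by (simp add: sets_baire_measurable_space)

text \<open>A sequence of proper subsets that eventually contains each point cannot be finite as a
  family, since a set that is repeated infinitely often contains every point.\<close>

lemma eventually_covering_infinite_range:
  assumes "\<And>k. b k \<subseteq> S" "\<And>k. b k \<noteq> S"
    and "\<And>x. x \<in> S \<Longrightarrow> \<forall>\<^sub>F k in sequentially. x \<in> b (k::nat)"
  shows "infinite (range b)"
proof
  assume "finite (range b)"
  then obtain k where "infinite {n \<in> UNIV. b n = b k}"
    using pigeonhole_infinite[of UNIV b] by auto
  then have freq: "\<exists>\<^sub>F n in sequentially. b n = b k"
    by (simp add: cofinite_eq_sequentially[symmetric] frequently_cofinite)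
  have "x \<in> b k" if "x \<in> S" for x
  proof -
    have "\<exists>\<^sub>F n in sequentially. x \<in> b n \<and> b n = b k"
      by (rule frequently_eventually_conj[OF freq assms(3)[OF that]])
    then show ?thesis
      by (auto dest!: frequently_ex)
  qed
  then show False
    using assms(1,2)[of k] by blast
qed

lemma eventually_covering_gamma_cover:
  assumes "\<And>k. b k \<in> baire_sets X" "\<And>k. b k \<noteq> topspace X"
    and "\<And>x. x \<in> topspace X \<Longrightarrow> \<forall>\<^sub>F k in sequentially. x \<in> b (k::nat)"
  shows "range b \<in> baire_gamma_covers X"
proof -
  have "infinite (range b)"
    by (rule eventually_covering_infinite_range) (fact baire_sets_subset[OF assms(1)] assms(2,3))+
  moreover have "\<Union>(range b) = topspace X"
  proof
    show "\<Union>(range b) \<subseteq> topspace X"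
      using assms(1) baire_sets_subset by blast
    show "topspace X \<subseteq> \<Union>(range b)"
      using assms(3) by (fastforce simp: eventually_sequentially)
  qed
  moreover have "finite {U \<in> range b. x \<notin> U}" if "x \<in> topspace X" for x
  proof -
    have "finite {k. x \<notin> b k}"
      using assms(3)[OF that] by (simp add: cofinite_eq_sequentially[symmetric] eventually_cofinite)
    then have "finite (b ` {k. x \<notin> b k})"
      by simp
    then show ?thesis
      by (rule rev_finite_subset) auto
  qed
  moreover have "topspace X \<notin> range b"
    using assms(2) by (metis rangeE)
  ultimately show ?thesis
    using assms(1) unfolding baire_gamma_covers_def gamma_cover_def
    by (simp add: image_subset_iff)
qed

lemma baire_index_selection_imp_S_one:
  assumes "baire_index_selection X"
  shows "S_one (baire_gamma_covers X) (baire_gamma_covers X)"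
  unfolding S_one_def
proof (intro allI impI)
  fix \<A> :: "nat \<Rightarrow> 'a set set"
  assume "\<forall>n. \<A> n \<in> baire_gamma_covers X"
  then have \<A>: "countable (\<A> n)" "gamma_cover X (\<A> n)" "\<A> n \<subseteq> baire_sets X" for n
    by (auto simp: baire_gamma_covers_def)
  define U where "U k = from_nat_into (\<A> k)" for k
  have U: "bij_betw (U k) UNIV (\<A> k)" for k
    using \<A>[of k] unfolding U_def gamma_cover_def by (intro bij_betw_from_nat_into) auto
  have U_in: "U k m \<in> \<A> k" for k m
    using U[of k] by (auto simp: bij_betw_def)
  have "\<forall>\<^sub>F m in sequentially. x \<in> U k m" if "x \<in> topspace X" for k x
  proof -
    have "finite {A \<in> \<A> k. x \<notin> A}"
      using \<A>(2)[of k] that by (auto simp: gamma_cover_def)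
    then have "finite (U k -` {A \<in> \<A> k. x \<notin> A})"
      using U[of k] by (intro finite_vimageI) (auto simp: bij_betw_def)
    then have "finite {m. x \<notin> U k m}"
      by (rule rev_finite_subset) (auto simp: U_in)
    then show ?thesis
      by (simp add: cofinite_eq_sequentially[symmetric] eventually_cofinite)
  qed
  then obtain m where m: "\<forall>x\<in>topspace X. \<forall>\<^sub>F k in sequentially. x \<in> U k (m k)"
    using assms \<A>(3) U_in unfolding baire_index_selection_def by blast
  have "range (\<lambda>k. U k (m k)) \<in> baire_gamma_covers X"
  proof (rule eventually_covering_gamma_cover)
    show "U k (m k) \<noteq> topspace X" for k
      using U_in[of k "m k"] \<A>(2)[of k] by (auto simp: gamma_cover_def)
  qed (use m \<A>(3) U_in in blast)+
  then show "\<exists>b. (\<forall>n. b n \<in> \<A> n) \<and> range b \<in> baire_gamma_covers X"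
    using U_in by (intro exI[of _ "\<lambda>k. U k (m k)"]) simp
qed

text \<open>The selected cover need not determine the selected indices well: one set may be chosen
  from many of the given covers, and then membership in almost all sets of the cover says little
  about almost all indices. Taking intersections first makes the given sets decreasing in \<open>k\<close>, so
  a set chosen at a later stage \<open>i\<close> can serve every stage before \<open>i\<close>, and only the first
  occurrences of the chosen sets matter.\<close>

lemma S_one_imp_baire_index_selection:
  assumes S: "S_one (baire_gamma_covers X) (baire_gamma_covers X)"
  shows "baire_index_selection X"
  unfolding baire_index_selection_def
proof (intro allI impI, elim conjE)
  fix U :: "nat \<Rightarrow> nat \<Rightarrow> 'a set"
  assume U: "\<forall>k m. U k m \<in> baire_sets X"
    and ev: "\<forall>k. \<forall>x\<in>topspace X. \<forall>\<^sub>F m in sequentially. x \<in> U k m"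
  define V where "V k m = (\<Inter>i\<le>k. U i m)" for k m
  have V_U: "V k m \<subseteq> U i m" if "i \<le> k" for i k m
    using that by (auto simp: V_def)
  have V_baire: "V k m \<in> baire_sets X" for k m
    using U unfolding V_def sets_baire_measurable_space[symmetric]
    by (intro sets.finite_INT) auto
  have V_ev: "\<forall>\<^sub>F m in sequentially. x \<in> V k m" if "x \<in> topspace X" for k x
    using ev that by (auto simp: V_def eventually_ball_finite_distrib)
  show "\<exists>m. \<forall>x\<in>topspace X. \<forall>\<^sub>F k in sequentially. x \<in> U k (m k)"
    \<comment> \<open>A family that contains the whole space is not a cover, but trivial to select from. By
      monotonicity either all \<open>k\<close> are of this kind or none from some \<open>k0\<close> on.\<close>
  proof (cases "\<forall>k. \<exists>m. V k m = topspace X")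
    case True
    then obtain m where "\<And>k. V k (m k) = topspace X"
      by metis
    then have "x \<in> U k (m k)" if "x \<in> topspace X" for x k
      using V_U[of k k "m k"] that by auto
    then show ?thesis
      by (intro exI[of _ m]) auto
  next
    case False
    then obtain k0 where k0: "\<And>m. V k0 m \<noteq> topspace X"
      by blast
    have proper: "V (k0 + k) m \<noteq> topspace X" for k m
    proof -
      have "V (k0 + k) m \<subseteq> V k0 m"
        by (auto simp: V_def)
      then show ?thesis
        using k0[of m] baire_sets_subset[OF V_baire[of k0 m]] by auto
    qed
    have "range (V (k0 + k)) \<in> baire_gamma_covers X" for k
      by (intro eventually_covering_gamma_cover V_baire proper V_ev)
    then have "\<exists>b. (\<forall>k. b k \<in> range (V (k0 + k))) \<and> range b \<in> baire_gamma_covers X"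
      using S unfolding S_one_def by simp
    then obtain b where b: "\<And>k. b k \<in> range (V (k0 + k))" "gamma_cover X (range b)"
      by (auto simp: baire_gamma_covers_def)
    have "\<forall>k. \<exists>m. b k = V (k0 + k) m"
      using b(1) by blast
    then obtain \<mu> where \<mu>: "\<And>k. b k = V (k0 + k) (\<mu> k)"
      by (auto dest!: choice)
    define I where "I = {i. \<forall>j<i. b j \<noteq> b i}"
    have inj: "inj_on b I"
      unfolding I_def inj_on_def by (metis (mono_tags, lifting) linorder_neqE_nat mem_Collect_eq)
    have "range b \<subseteq> b ` I"
    proof safe
      fix k
      define i where "i = (LEAST i. b i = b k)"
      have i: "b i = b k"
        unfolding i_def by (rule LeastI) (rule refl)
      have "b j \<noteq> b k" if "j < i" for j
        using not_less_Least[of j "\<lambda>i. b i = b k"] that unfolding i_def by blast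
      then have "i \<in> I"
        by (simp add: I_def i)
      then show "b k \<in> b ` I"
        using i by (metis image_eqI)
    qed
    moreover have "infinite (range b)"
      using b(2) by (simp add: gamma_cover_def)
    ultimately have "infinite I"
      using finite_subset by blast
    then have "\<forall>k. \<exists>i. i \<in> I \<and> i \<ge> k"
      unfolding infinite_nat_iff_unbounded_le by blast
    then obtain r where r: "\<And>k. r k \<in> I" "\<And>k. r k \<ge> k"
      by (auto dest!: choice)
    have "\<forall>\<^sub>F k in sequentially. x \<in> U k (\<mu> (r (k - k0)))" if x: "x \<in> topspace X" for x
    proof -
      have "finite {A \<in> range b. x \<notin> A}"
        using b(2) x by (auto simp: gamma_cover_def)
      then have "finite {i \<in> I. x \<notin> b i}"
        by (intro finite_imageD[OF _ inj_on_subset[OF inj]])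
          (auto elim: rev_finite_subset)
      then obtain N where N: "\<And>i. i \<in> I \<Longrightarrow> x \<notin> b i \<Longrightarrow> i \<le> N"
        by (auto simp: finite_nat_set_iff_bounded_le)
      have "x \<in> U k (\<mu> (r (k - k0)))" if k: "k \<ge> k0 + Suc N" for k
      proof -
        have "x \<in> b (r (k - k0))"
          using N[OF r(1)[of "k - k0"]] r(2)[of "k - k0"] k by linarith
        moreover have "k \<le> k0 + r (k - k0)"
          using r(2)[of "k - k0"] by linarith
        ultimately show ?thesis
          using \<mu>[of "r (k - k0)"] V_U by blast
      qed
      then show ?thesis
        by (auto simp: eventually_sequentially)
    qed
    then show ?thesis
      by (intro exI[of _ "\<lambda>k. \<mu> (r (k - k0))"]) simp
  qed
qed

text \<open>The limits \<open>f k\<close> are arbitrary. If they converge in turn, the selected terms have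
  the same limit, so iterated sequential limits are limits of single sequences.\<close>

definition baire_diagonal :: "'a topology \<Rightarrow> bool" where
  "baire_diagonal X \<longleftrightarrow>
     (\<forall>(g::nat \<Rightarrow> nat \<Rightarrow> 'a \<Rightarrow> real) f.
        (\<forall>k m. g k m \<in> baire_functions X) \<and> (\<forall>k. f k \<in> baire_functions X) \<and>
        (\<forall>k. converges_pointwise X (g k) (f k)) \<longrightarrow>
        (\<exists>m. converges_pointwise X (\<lambda>k x. g k (m k) x - f k x) (\<lambda>_. 0)))"

lemma baire_index_selection_imp_diagonal:
  assumes "baire_index_selection X"
  shows "baire_diagonal X"
  unfolding baire_diagonal_def
proof (intro allI impI, elim conjE)
  fix g :: "nat \<Rightarrow> nat \<Rightarrow> 'a \<Rightarrow> real" and f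
  assume g: "\<forall>k m. g k m \<in> baire_functions X" and f: "\<forall>k. f k \<in> baire_functions X"
    and lim: "\<forall>k. converges_pointwise X (g k) (f k)"
  define U where "U k m = {x \<in> topspace X. \<bar>g k m x - f k x\<bar> < inverse (real (Suc k))}" for k m
  have "U k m \<in> baire_sets X" for k m
  proof -
    have [measurable]: "g k m \<in> borel_measurable (baire_measurable_space X)"
        "f k \<in> borel_measurable (baire_measurable_space X)"
      using f g by (auto intro: baire_functions_measurable)
    have "{x \<in> space (baire_measurable_space X). \<bar>g k m x - f k x\<bar> < inverse (real (Suc k))}
        \<in> sets (baire_measurable_space X)"
      by measurable
    then show ?thesis
      by (simp add: U_def sets_baire_measurable_space)
  qed
  moreover have "\<forall>\<^sub>F m in sequentially. x \<in> U k m" if "x \<in> topspace X" for k x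
  proof -
    have "(\<lambda>m. g k m x) \<longlonglongrightarrow> f k x"
      using lim that by (auto simp: converges_pointwise_def)
    from tendstoD[OF this, of "inverse (real (Suc k))"] show ?thesis
      using that by (simp add: U_def dist_real_def)
  qed
  ultimately obtain m where m: "\<And>x. x \<in> topspace X \<Longrightarrow> \<forall>\<^sub>F k in sequentially. x \<in> U k (m k)"
    using assms unfolding baire_index_selection_def by meson
  have "(\<lambda>k. g k (m k) x - f k x) \<longlonglongrightarrow> 0" if "x \<in> topspace X" for x
  proof (rule Lim_null_comparison[OF _ LIMSEQ_inverse_real_of_nat])
    show "\<forall>\<^sub>F k in sequentially. norm (g k (m k) x - f k x) \<le> inverse (real (Suc k))"
      using m[OF that] by eventually_elim (simp add: U_def)
  qed
  then show "\<exists>m. converges_pointwise X (\<lambda>k x. g k (m k) x - f k x) (\<lambda>_. 0)"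
    by (auto simp: converges_pointwise_def)
qed


section \<open>The O-property and sequential separability\<close>

lemma tychonoff_functionally_separated:
  assumes "tychonoff_space X" "x \<in> topspace X" "y \<in> topspace X" "x \<noteq> y"
  obtains f where "f \<in> baire_functions X" "f x \<noteq> f y"
proof -
  have "closedin X {y}"
    using assms by (simp add: tychonoff_space_def closedin_Hausdorff_sing_eq)
  then obtain f where f: "continuous_map X euclideanreal f" "f x = 0" "f ` {y} \<subseteq> {1}"
    using assms unfolding tychonoff_space_def completely_regular_space_alt by blast
  show thesis
    using that[OF restrict_continuous_in_baire_functions[OF f(1)]] assms f by simp
qed

lemma baire_functions_nonempty: "baire_functions X \<noteq> {}"
  using restrict_continuous_in_baire_functions[of X "\<lambda>_. 0"] by auto

text \<open>A countable sequentially dense set \<open>d\<^sub>0, d\<^sub>1, \<dots>\<close> provides the map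
  \<open>x \<mapsto> (d\<^sub>i(x))\<^sub>i\<close> into the metrizable space of real sequences. It is
  injective because the continuous functions, being limits of the \<open>d\<^sub>i\<close>, separate points.
  For the topology it induces, the \<open>d\<^sub>i\<close> are continuous, and the indicator of a Baire set is
  the limit of some of them, which presents the Baire set as an \<open>F\<^sub>\<sigma>\<close>-set.\<close>

lemma sequentially_separable_imp_O_property:
  fixes X :: "'a topology"
  assumes X: "tychonoff_space X"
    and sep: "sequentially_separable_space (baire_function_space X)"
  shows "O_property X"
proof -
  obtain D where "D \<in> countable_seq_dense_families X"
    using sep by (auto simp: sequentially_separable_iff)
  then have D: "countable D" "D \<subseteq> baire_functions X"
      "\<And>f. f \<in> baire_functions X \<Longrightarrow> \<exists>s. range s \<subseteq> D \<and> converges_pointwise X s f"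
    by (auto simp: countable_seq_dense_families_iff)
  have "D \<noteq> {}"
    using D(3) baire_functions_nonempty[of X] by fastforce
  define d where "d = from_nat_into D"
  have d: "range d = D"
    using D(1) \<open>D \<noteq> {}\<close> by (simp add: d_def)
  define \<Phi> where "\<Phi> x = (\<lambda>i. d i x)" for x
  define Y where "Y = pullback_topology (topspace X) \<Phi> euclidean"
  have top: "topspace Y = topspace X"
    by (simp add: Y_def topspace_pullback_topology)
  have open_Y: "openin Y S \<longleftrightarrow> (\<exists>U. open U \<and> S = \<Phi> -` U \<inter> topspace X)" for S
    by (simp add: Y_def openin_pullback_topology)
  have inj: "inj_on \<Phi> (topspace X)"
  proof (rule inj_onI, rule ccontr)
    fix x y
    assume xy: "x \<in> topspace X" "y \<in> topspace X" "\<Phi> x = \<Phi> y" "x \<noteq> y"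
    then obtain f where f: "f \<in> baire_functions X" "f x \<noteq> f y"
      using tychonoff_functionally_separated[OF X] by metis
    then obtain s where s: "range s \<subseteq> D" "converges_pointwise X s f"
      using D(3) by blast
    have "s n x = s n y" for n
    proof -
      obtain i where "s n = d i"
        using s(1) d by blast
      then show ?thesis
        using fun_cong[OF xy(3), of i] by (simp add: \<Phi>_def)
    qed
    then have "(\<lambda>n. s n x) = (\<lambda>n. s n y)"
      by (rule ext)
    moreover have "(\<lambda>n. s n x) \<longlonglongrightarrow> f x" "(\<lambda>n. s n y) \<longlonglongrightarrow> f y"
      using s(2) xy unfolding converges_pointwise_def by blast+
    ultimately have "f x = f y"
      by (simp only: LIMSEQ_unique)
    with f(2) show False
      by contradiction
  qed
  have "homeomorphic_map Y (top_of_set (\<Phi> ` topspace X)) \<Phi>"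
  proof (rule bijective_open_imp_homeomorphic_map)
    show "continuous_map Y (top_of_set (\<Phi> ` topspace X)) \<Phi>"
      unfolding continuous_map_in_subtopology
      by (auto simp: continuous_map_def open_Y top)
    show "open_map Y (top_of_set (\<Phi> ` topspace X)) \<Phi>"
      unfolding open_map_def open_Y openin_open by auto
  qed (use inj top in auto)
  then have homeo: "Y homeomorphic_space top_of_set (\<Phi> ` topspace X)"
    by (rule homeomorphic_map_imp_homeomorphic_space)
  have "metrizable_space Y"
    using homeomorphic_metrizable_space[OF homeo]
    by (simp add: metrizable_space_subtopology metrizable_space_euclidean)
  moreover have "separable_space Y"
  proof -
    have "second_countable (euclidean :: (nat \<Rightarrow> real) topology)"
    proof -
      obtain B :: "(nat \<Rightarrow> real) set set" where "countable B" "topological_basis B"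
        using ex_countable_basis by blast
      then show ?thesis
        unfolding second_countable_def
        by (metis open_openin topological_basis_open topological_basisE)
    qed
    then have "separable_space (top_of_set (\<Phi> ` topspace X))"
      by (intro second_countable_imp_separable_space second_countable_subtopology)
    then show ?thesis
      using homeomorphic_separable_space[OF homeo] by simp
  qed
  moreover have "{x \<in> topspace X. id x \<in> U} \<in> baire_sets X" if U: "openin Y U" for U
  proof -
    obtain V where V: "open V" "U = \<Phi> -` V \<inter> topspace X"
      using U open_Y by blast
    have "d i \<in> borel_measurable (baire_measurable_space X)" for i
      using D(2) d by (intro baire_functions_measurable) auto
    then have "\<Phi> \<in> borel_measurable (baire_measurable_space X)"
      unfolding \<Phi>_def by (intro measurable_coordinatewise_then_product)
    then have "\<Phi> -` V \<inter> space (baire_measurable_space X) \<in> sets (baire_measurable_space X)"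
      using V(1) by (intro measurable_sets) auto
    moreover have "{x \<in> topspace X. id x \<in> U} = \<Phi> -` V \<inter> space (baire_measurable_space X)"
      using V(2) by auto
    ultimately show ?thesis
      by (simp only: sets_baire_measurable_space)
  qed
  moreover have "fsigma_in Y (id ` T)" if T: "T \<in> baire_sets X" for T
  proof -
    have "restrict (indicator T) (topspace X) \<in> baire_functions X"
      using T unfolding restrict_in_baire_functions_iff sets_baire_measurable_space[symmetric]
      by (rule borel_measurable_indicator)
    then obtain s where s: "range s \<subseteq> D"
        "converges_pointwise X s (restrict (indicator T) (topspace X))"
      using D(3) by blast
    have lim: "(\<lambda>n. s n x) \<longlonglongrightarrow> indicator T x" if "x \<in> topspace X" for x
      using s(2) that by (auto simp: converges_pointwise_def)
    have cont: "continuous_map Y euclideanreal (s n)" for n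
    proof -
      obtain i where i: "s n = d i"
        using s(1) d by blast
      have "continuous_map euclidean euclideanreal (\<lambda>u::nat \<Rightarrow> real. u i)"
        by (auto intro: continuous_intros)
      then have "continuous_map Y euclideanreal ((\<lambda>u. u i) \<circ> \<Phi>)"
        unfolding Y_def by (rule continuous_map_pullback)
      then show ?thesis
        using i by (simp add: \<Phi>_def o_def)
    qed
    define C where "C n = (\<Inter>k\<in>{n..}. {x \<in> topspace Y. s k x \<in> {1/2..}})" for n
    have "closedin Y (C n)" for n
      unfolding C_def
      by (intro closedin_INT closedin_continuous_map_preimage[OF cont]) auto
    moreover have "(\<Union>n. C n) = T"
    proof safe
      fix x n
      assume x: "x \<in> C n"
      then have "x \<in> topspace X"
        by (auto simp: C_def top)
      moreover have "\<forall>k\<ge>n. 1/2 \<le> s k x"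
        using x by (auto simp: C_def)
      ultimately have "1/2 \<le> indicat_real T x"
        using lim by (intro LIMSEQ_le_const[of "\<lambda>n. s n x"]) auto
      then show "x \<in> T"
        by (cases "x \<in> T") simp_all
    next
      fix x
      assume x: "x \<in> T"
      then have xX: "x \<in> topspace X"
        using baire_sets_subset[OF T] by auto
      then have "\<forall>\<^sub>F n in sequentially. 1/2 < s n x"
        using order_tendstoD(1)[OF lim[OF xX], of "1/2"] x by simp
      then obtain n where "\<forall>k\<ge>n. 1/2 < s k x"
        by (auto simp: eventually_sequentially)
      then have "x \<in> C n"
        using xX by (auto simp: C_def top less_imp_le)
      then show "x \<in> (\<Union>n. C n)"
        by blast
    qed
    ultimately show ?thesis
      unfolding fsigma_in_def image_id id_apply
      by (subst countable_union_of_explicit) auto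
  qed
  ultimately show ?thesis
    unfolding O_property_def using top bij_betw_id[of "topspace X"] by metis
qed

lemma metrizable_separable_countable_base:
  assumes "metrizable_space Y" "separable_space Y"
  obtains \<B> where "countable \<B>" "\<And>V. V \<in> \<B> \<Longrightarrow> openin Y V"
    "\<And>U. openin Y U \<Longrightarrow> U = \<Union>{V \<in> \<B>. V \<subseteq> U}"
proof -
  obtain M d where "Metric_space M d" and Y: "Y = Metric_space.mtopology M d"
    using assms(1) by (auto simp: metrizable_space_def)
  interpret Metric_space M d
    by fact
  obtain C where C: "countable C" "C \<subseteq> M" "mtopology closure_of C = M"
    using assms(2) by (auto simp: separable_space_def Y)
  define \<B> where "\<B> = (\<lambda>(c, n). mball c (inverse (real (Suc n)))) ` (C \<times> UNIV)"
  show thesis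
  proof (rule that)
    show "countable \<B>"
      using C by (auto simp: \<B>_def)
    show "openin Y V" if "V \<in> \<B>" for V
      using that by (auto simp: \<B>_def Y)
    fix U
    assume U: "openin Y U"
    show "U = \<Union>{V \<in> \<B>. V \<subseteq> U}"
    proof safe
      fix x
      assume x: "x \<in> U"
      then have xM: "x \<in> M" and "\<exists>e>0. mball x e \<subseteq> U"
        using U by (auto simp: Y openin_mtopology)
      then obtain e where e: "e > 0" "mball x e \<subseteq> U"
        by blast
      obtain n where n: "inverse (real (Suc n)) < e / 2"
        using reals_Archimedean[of "e / 2"] e by auto
      have "C \<inter> mball x (inverse (real (Suc n))) \<noteq> {}"
      proof -
        have "x \<in> mball x (inverse (real (Suc n)))"
          using xM by simp
        then show ?thesis
          using C(3) dense_intersects_open[of mtopology C] openin_mball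
          by (metis empty_iff topspace_mtopology)
      qed
      then obtain c where c: "c \<in> C" "c \<in> mball x (inverse (real (Suc n)))"
        by blast
      have "mball c (inverse (real (Suc n))) \<subseteq> U"
      proof
        fix y
        assume y: "y \<in> mball c (inverse (real (Suc n)))"
        then have "d x y < e"
          using triangle[of x c y] c n xM by (auto simp: in_mball)
        then show "y \<in> U"
          using e(2) xM y by (auto simp: in_mball)
      qed
      moreover have "x \<in> mball c (inverse (real (Suc n)))"
        using c xM by (auto simp: in_mball commute)
      ultimately show "x \<in> \<Union>{V \<in> \<B>. V \<subseteq> U}"
        using c(1) by (auto simp: \<B>_def)
    qed blast
  qed
qed

text \<open>The generator consists of the preimages of a countable base of \<open>Y\<close>, closed under finite
  intersections. As the image of a Baire set is an \<open>F\<^sub>\<sigma>\<close>-set, the Baire set is a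
  countable union of preimages of closed sets, and these are in the generated
  \<open>\<sigma>\<close>-algebra.\<close>

lemma O_property_imp_countably_generated:
  assumes "O_property X"
  obtains G where "countable G" "Int_stable G" "topspace X \<in> G"
    "G \<subseteq> baire_sets X" "baire_sets X \<subseteq> sigma_sets (topspace X) G"
proof -
  obtain Y :: "'a topology" and \<phi>
    where Y: "metrizable_space Y" "separable_space Y"
      and \<phi>: "bij_betw \<phi> (topspace X) (topspace Y)"
      and pre: "\<And>U. openin Y U \<Longrightarrow> {x \<in> topspace X. \<phi> x \<in> U} \<in> baire_sets X"
      and img: "\<And>T. T \<in> baire_sets X \<Longrightarrow> fsigma_in Y (\<phi> ` T)"
    using assms by (auto simp: O_property_def)
  obtain \<B> where \<B>: "countable \<B>" "\<And>V. V \<in> \<B> \<Longrightarrow> openin Y V"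
      "\<And>U. openin Y U \<Longrightarrow> U = \<Union>{V \<in> \<B>. V \<subseteq> U}"
    using metrizable_separable_countable_base[OF Y] by blast
  define P where "P V = {x \<in> topspace X. \<phi> x \<in> V}" for V
  define G where "G = (\<lambda>F. topspace X \<inter> \<Inter>F) ` {F. F \<subseteq> P ` \<B> \<and> finite F}"
  have "countable G"
    using \<B>(1) unfolding G_def by (subst conj_commute)
      (intro countable_image countable_Collect_finite_subset)
  moreover have "Int_stable G"
  proof (rule Int_stableI)
    fix A B
    assume "A \<in> G" "B \<in> G"
    then obtain F F' where "A = topspace X \<inter> \<Inter>F" "F \<subseteq> P ` \<B>" "finite F"
        "B = topspace X \<inter> \<Inter>F'" "F' \<subseteq> P ` \<B>" "finite F'"
      unfolding G_def by blast
    then show "A \<inter> B \<in> G"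
      unfolding G_def by (intro image_eqI[of _ _ "F \<union> F'"]) auto
  qed
  moreover have "topspace X \<in> G"
    unfolding G_def by (rule image_eqI[of _ _ "{}"]) auto
  moreover have "G \<subseteq> baire_sets X"
  proof
    fix A
    assume "A \<in> G"
    then obtain F where F: "A = topspace X \<inter> \<Inter>F" "F \<subseteq> P ` \<B>" "finite F"
      unfolding G_def by blast
    show "A \<in> baire_sets X"
    proof (cases "F = {}")
      case True
      then show ?thesis
        using F sets.top[of "baire_measurable_space X"] by (simp add: sets_baire_measurable_space)
    next
      case False
      have sub: "F \<subseteq> baire_sets X"
        using F(2) \<B>(2) pre by (auto simp: P_def)
      then have "\<Inter>F \<in> baire_sets X"
        using F(3) False sets.finite_INT[of F "\<lambda>A. A" "baire_measurable_space X"]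
        by (simp add: sets_baire_measurable_space subset_iff)
      moreover have "A = \<Inter>F"
        using F(1) False sub baire_sets_subset by blast
      ultimately show ?thesis
        by simp
    qed
  qed
  moreover have "baire_sets X \<subseteq> sigma_sets (topspace X) G"
  proof
    let ?N = "sigma (topspace X) G"
    have "G \<subseteq> Pow (topspace X)"
      unfolding G_def by auto
    then have N: "space ?N = topspace X" "sets ?N = sigma_sets (topspace X) G"
      by simp_all
    have "P V \<in> G" if "V \<in> \<B>" for V
      using that unfolding G_def by (intro image_eqI[of _ _ "{P V}"]) (auto simp: P_def)
    then have base: "P V \<in> sets ?N" if "V \<in> \<B>" for V
      using that N by (metis sigma_sets.Basic)
    have opn: "P U \<in> sets ?N" if "openin Y U" for U
    proof -
      have "P U = (\<Union>V\<in>{V \<in> \<B>. V \<subseteq> U}. P V)"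
        using \<B>(3)[OF that] unfolding P_def by blast
      also have "\<dots> \<in> sets ?N"
        using \<B>(1) base by (intro sets.countable_UN') auto
      finally show ?thesis .
    qed
    have cls: "P C \<in> sets ?N" if "closedin Y C" for C
    proof -
      have "P C = space ?N - P (topspace Y - C)"
        using \<phi> N by (auto simp: P_def bij_betw_def)
      moreover have "P (topspace Y - C) \<in> sets ?N"
        using that by (intro opn) (simp add: closedin_def)
      ultimately show ?thesis
        by (simp only: sets.compl_sets)
    qed
    fix T
    assume T: "T \<in> baire_sets X"
    obtain C where C: "\<And>n::nat. closedin Y (C n)" "\<Union>(range C) = \<phi> ` T"
      using img[OF T] by (auto simp: fsigma_in_ascending)
    have "T = P (\<phi> ` T)"
      using \<phi> baire_sets_subset[OF T] by (auto simp: P_def bij_betw_def dest: inj_onD)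
    also have "\<dots> = (\<Union>n. P (C n))"
      unfolding C(2)[symmetric] P_def by blast
    also have "\<dots> \<in> sets ?N"
      using cls C(1) by blast
    finally show "T \<in> sigma_sets (topspace X) G"
      using N by simp
  qed
  ultimately show thesis
    by (rule that)
qed

lemma rational_sequence_converges:
  obtains q :: "nat \<Rightarrow> real" where "\<And>n. q n \<in> \<rat>" "q \<longlonglongrightarrow> c"
proof -
  have "\<forall>n. \<exists>q\<in>\<rat>. c < q \<and> q < c + inverse (real (Suc n))"
    by (intro allI Rats_dense_in_real) simp
  then obtain q where q: "\<And>n. q n \<in> \<rat>" "\<And>n. c < q n" "\<And>n. q n < c + inverse (real (Suc n))"
    by metis
  have lim: "(\<lambda>n. c + inverse (real (Suc n))) \<longlonglongrightarrow> c"
    using tendsto_add[OF tendsto_const LIMSEQ_inverse_real_of_nat, of c] by simp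
  have "q \<longlonglongrightarrow> c"
    by (rule real_tendsto_sandwich[OF _ _ tendsto_const lim]) (auto intro!: always_eventually less_imp_le q simp del: of_nat_Suc)
  then show thesis
    using q(1) that by blast
qed

lemma diagonal_limit:
  assumes "baire_diagonal X"
    and g: "\<And>k m. g k m \<in> baire_functions X" and f: "\<And>k. f k \<in> baire_functions X"
    and "\<And>k. converges_pointwise X (g k) (f k)" and h: "converges_pointwise X f h"
  obtains m where "converges_pointwise X (\<lambda>k. g k (m k)) h"
proof -
  obtain m where m: "converges_pointwise X (\<lambda>k x. g k (m k) x - f k x) (\<lambda>_. 0)"
    using assms unfolding baire_diagonal_def by meson
  have "converges_pointwise X (\<lambda>k. g k (m k)) h"
    unfolding converges_pointwise_def
  proof
    fix x
    assume "x \<in> topspace X"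
    then have "(\<lambda>k. (g k (m k) x - f k x) + f k x) \<longlonglongrightarrow> 0 + h x"
      using m h by (intro tendsto_add) (auto simp: converges_pointwise_def)
    then show "(\<lambda>k. g k (m k) x) \<longlonglongrightarrow> h x"
      by simp
  qed
  then show thesis
    by (rule that)
qed

text \<open>The diagonal property makes the sequential closure of a set of functions closed
  under limits of sequences. So the rational combinations of indicators of the sets of a countable
  generator, of which there are only countably many, are sequentially dense.\<close>

lemma O_property_imp_sequentially_separable:
  assumes diag: "baire_diagonal X" and O: "O_property X"
  shows "sequentially_separable_space (baire_function_space X)"
proof -
  obtain G where G: "countable G" "Int_stable G" "topspace X \<in> G"
      "G \<subseteq> baire_sets X" "baire_sets X \<subseteq> sigma_sets (topspace X) G"
    using O_property_imp_countably_generated[OF O] by blast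
  define comb where
    "comb l = (\<lambda>x\<in>topspace X. \<Sum>p\<leftarrow>l. fst p * indicat_real (snd p) x)" for l :: "(real \<times> 'a set) list"
  define D where "D = comb ` lists (\<rat> \<times> G)"
  have D_add: "(\<lambda>x\<in>topspace X. f x + g x) \<in> D" if fg: "f \<in> D" "g \<in> D" for f g
  proof -
    obtain l l' where l: "l \<in> lists (\<rat> \<times> G)" "f = comb l" "l' \<in> lists (\<rat> \<times> G)" "g = comb l'"
      using fg unfolding D_def by blast
    have "comb (l @ l') = (\<lambda>x\<in>topspace X. f x + g x)"
      unfolding l comb_def by (rule restrict_ext) simp
    then show ?thesis
      unfolding D_def using l by (intro image_eqI[of _ _ "l @ l'"]) auto
  qed
  have D_scale: "(\<lambda>x\<in>topspace X. q * f x) \<in> D" if f: "f \<in> D" and q: "q \<in> \<rat>" for f q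
  proof -
    obtain l where l: "l \<in> lists (\<rat> \<times> G)" "f = comb l"
      using f unfolding D_def by blast
    define l' where "l' = map (\<lambda>p. (q * fst p, snd p)) l"
    have "comb l' = (\<lambda>x\<in>topspace X. q * f x)"
      unfolding l l'_def comb_def
      by (rule restrict_ext) (simp add: sum_list_const_mult o_def mult.assoc)
    moreover have "l' \<in> lists (\<rat> \<times> G)"
      using l(1) q by (auto simp: l'_def in_lists_conv_set)
    ultimately show ?thesis
      unfolding D_def by (intro image_eqI[of _ _ l']) auto
  qed
  have D_ind: "restrict (indicator A) (topspace X) \<in> D" if "A \<in> G" for A
    unfolding D_def
  proof (rule image_eqI)
    show "restrict (indicator A) (topspace X) = comb [(1, A)]"
      unfolding comb_def by (rule restrict_ext) simp
  qed (use that in auto)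
  have D_baire: "D \<subseteq> baire_functions X"
  proof
    fix f
    assume "f \<in> D"
    then obtain l where l: "l \<in> lists (\<rat> \<times> G)" "f = comb l"
      unfolding D_def by blast
    have "(\<lambda>x. \<Sum>p\<leftarrow>l. fst p * indicat_real (snd p) x) \<in> borel_measurable (baire_measurable_space X)"
      using l(1)
    proof (induction l)
      case (Cons p l)
      then have "snd p \<in> sets (baire_measurable_space X)"
        using G(4) by (auto simp: sets_baire_measurable_space)
      then have "(\<lambda>x. fst p * indicat_real (snd p) x) \<in> borel_measurable (baire_measurable_space X)"
        by measurable
      with Cons show ?case
        by simp
    qed simp
    then show "f \<in> baire_functions X"
      unfolding l comb_def restrict_in_baire_functions_iff .
  qed
  define Q where "Q = {f \<in> baire_functions X. \<exists>s. range s \<subseteq> D \<and> converges_pointwise X s f}"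
  have "f \<in> Q" if f: "f \<in> baire_functions X" for f
  proof (rule functional_monotone_class[OF G(2) _ G(3)])
    show "G \<subseteq> Pow (topspace X)"
      using G(4) baire_sets_subset by blast
    then have "sets (sigma (topspace X) G) = sigma_sets (topspace X) G"
      by simp
    then have "sets (baire_measurable_space X) \<subseteq> sets (sigma (topspace X) G)"
      using G(5) by (simp only: sets_baire_measurable_space)
    moreover have "f \<in> borel_measurable (baire_measurable_space X)"
      using f by (rule baire_functions_measurable)
    ultimately show "f \<in> borel_measurable (sigma (topspace X) G)"
      using \<open>G \<subseteq> Pow (topspace X)\<close>
      by (auto simp: measurable_def)
    show "f \<in> extensional (topspace X)"
      using f unfolding baire_functions_eq by blast
  next
    fix A
    assume "A \<in> G"
    then have "restrict (indicator A) (topspace X) \<in> D"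
      by (rule D_ind)
    then show "restrict (indicator A) (topspace X) \<in> Q"
      unfolding Q_def using D_baire
      by (auto simp: converges_pointwise_def
          intro!: exI[of _ "\<lambda>_. restrict (indicator A) (topspace X)"])
  next
    fix f g
    assume "f \<in> Q" "g \<in> Q"
    then obtain s t where s: "f \<in> baire_functions X" "range s \<subseteq> D" "converges_pointwise X s f"
      and t: "g \<in> baire_functions X" "range t \<subseteq> D" "converges_pointwise X t g"
      unfolding Q_def by blast
    have "range (\<lambda>n. \<lambda>x\<in>topspace X. s n x + t n x) \<subseteq> D"
      using s t D_add by blast
    moreover have "converges_pointwise X (\<lambda>n. \<lambda>x\<in>topspace X. s n x + t n x)
        (\<lambda>x\<in>topspace X. f x + g x)"
      using s(3) t(3) by (auto simp: converges_pointwise_def intro: tendsto_add)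
    ultimately show "(\<lambda>x\<in>topspace X. f x + g x) \<in> Q"
      unfolding Q_def using baire_functions_add[OF s(1) t(1)] by blast
  next
    fix c :: real and f
    assume "f \<in> Q"
    then obtain s where s: "f \<in> baire_functions X" "range s \<subseteq> D" "converges_pointwise X s f"
      unfolding Q_def by blast
    obtain q where q: "\<And>n. q n \<in> \<rat>" "q \<longlonglongrightarrow> c"
      using rational_sequence_converges[of c] by blast
    have "range (\<lambda>n. \<lambda>x\<in>topspace X. q n * s n x) \<subseteq> D"
      using s q D_scale by blast
    moreover have "converges_pointwise X (\<lambda>n. \<lambda>x\<in>topspace X. q n * s n x)
        (\<lambda>x\<in>topspace X. c * f x)"
      using s(3) q(2) by (auto simp: converges_pointwise_def intro: tendsto_mult)
    ultimately show "(\<lambda>x\<in>topspace X. c * f x) \<in> Q"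
      unfolding Q_def using baire_functions_scale[OF s(1)] by blast
  next
    fix F :: "nat \<Rightarrow> 'a \<Rightarrow> real" and f
    assume F: "\<And>n. F n \<in> Q" and f: "f \<in> extensional (topspace X)"
      and lim: "\<And>x. x \<in> topspace X \<Longrightarrow> (\<lambda>n. F n x) \<longlonglongrightarrow> f x"
    have "\<forall>n. \<exists>s. range s \<subseteq> D \<and> converges_pointwise X s (F n)"
      using F unfolding Q_def by blast
    then obtain s where s: "\<And>n. range (s n) \<subseteq> D" "\<And>n. converges_pointwise X (s n) (F n)"
      by (auto dest!: choice)
    have F_baire: "F n \<in> baire_functions X" for n
      using F unfolding Q_def by blast
    have s_baire: "s n m \<in> baire_functions X" for n m
      using s(1) D_baire by blast
    have "converges_pointwise X F f"
      using lim by (simp add: converges_pointwise_def)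
    then obtain m where "converges_pointwise X (\<lambda>n. s n (m n)) f"
      using diagonal_limit[OF diag, of s F f, OF s_baire F_baire s(2)] by blast
    moreover have "range (\<lambda>n. s n (m n)) \<subseteq> D"
      using s(1) by blast
    moreover have "f \<in> baire_functions X"
      by (rule baire_functions.limit[OF F_baire f lim])
    ultimately show "f \<in> Q"
      unfolding Q_def by blast
  qed
  moreover have "countable D"
    unfolding D_def by (intro countable_image countable_lists countable_SIGMA countable_rat G(1))
  ultimately have "D \<in> countable_seq_dense_families X"
    using D_baire unfolding countable_seq_dense_families_iff Q_def by blast
  then show ?thesis
    by (auto simp: sequentially_separable_iff)
qed


section \<open>From the diagonal property to the selection principles\<close>

lemma eventually_approximates_iff:
  "eventually_approximates X F f \<longleftrightarrow>
     (\<forall>x\<in>topspace X. \<forall>e>0. \<forall>\<^sub>F n in sequentially. \<exists>g\<in>F n. \<bar>g x - f x\<bar> < e)"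
proof
  assume F: "eventually_approximates X F f"
  show "\<forall>x\<in>topspace X. \<forall>e>0. \<forall>\<^sub>F n in sequentially. \<exists>g\<in>F n. \<bar>g x - f x\<bar> < e"
  proof (intro ballI allI impI)
    fix x and e :: real
    assume "x \<in> topspace X" "e > 0"
    then obtain n' where "\<forall>n>n'. \<forall>y\<in>{x}. \<exists>g\<in>F n. \<bar>g y - f y\<bar> < e"
      using F unfolding eventually_approximates_def
      by (metis empty_subsetI finite.emptyI finite.insertI insert_subset)
    then show "\<forall>\<^sub>F n in sequentially. \<exists>g\<in>F n. \<bar>g x - f x\<bar> < e"
      unfolding eventually_at_top_dense by blast
  qed
next
  assume *: "\<forall>x\<in>topspace X. \<forall>e>0. \<forall>\<^sub>F n in sequentially. \<exists>g\<in>F n. \<bar>g x - f x\<bar> < e"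
  show "eventually_approximates X F f"
    unfolding eventually_approximates_def
  proof (intro allI impI, elim conjE)
    fix K and e :: real
    assume K: "finite K" "K \<subseteq> topspace X" "e > 0"
    have "\<forall>\<^sub>F n in sequentially. \<forall>x\<in>K. \<exists>g\<in>F n. \<bar>g x - f x\<bar> < e"
      using K * by (intro eventually_ball_finite) blast+
    then obtain N where "\<forall>n\<ge>N. \<forall>x\<in>K. \<exists>g\<in>F n. \<bar>g x - f x\<bar> < e"
      unfolding eventually_sequentially by blast
    then show "\<exists>n'. \<forall>n>n'. \<forall>x\<in>K. \<exists>g\<in>F n. \<bar>g x - f x\<bar> < e"
      by (meson less_imp_le)
  qed
qed

lemma converges_imp_eventually_approximates:
  assumes "converges_pointwise X s f" "\<And>n. s n \<in> F n"
  shows "eventually_approximates X F f"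
  unfolding eventually_approximates_iff
proof (intro ballI allI impI)
  fix x and e :: real
  assume "x \<in> topspace X" "e > 0"
  then have "\<forall>\<^sub>F n in sequentially. dist (s n x) (f x) < e"
    using assms(1) by (auto simp: converges_pointwise_def tendsto_iff)
  then show "\<forall>\<^sub>F n in sequentially. \<exists>g\<in>F n. \<bar>g x - f x\<bar> < e"
    by eventually_elim (use assms(2) in \<open>auto simp: dist_real_def\<close>)
qed

text \<open>To reach \<open>f\<close> without using \<open>f\<close> itself, the diagonal runs through sequences that converge to
  \<open>f + 1/(n+1)\<close>; their terms eventually differ from \<open>f\<close> at a chosen point.\<close>

lemma diagonal_selection_from_dense:
  assumes diag: "baire_diagonal X" and ne: "topspace X \<noteq> {}"
    and S: "\<And>n. S n \<in> countable_seq_dense_families X" and f: "f \<in> baire_functions X"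
  obtains b where "\<And>n. b n \<in> S n" "\<And>n. b n \<noteq> f" "converges_pointwise X b f"
proof -
  obtain x0 where x0: "x0 \<in> topspace X"
    using ne by blast
  define h where "h n = (\<lambda>x\<in>topspace X. f x + inverse (real (Suc n)))" for n
  have h: "h n \<in> baire_functions X" for n
    unfolding h_def restrict_in_baire_functions_iff
    by (intro borel_measurable_add borel_measurable_const baire_functions_measurable f)
  have "\<exists>s. range s \<subseteq> S n \<and> (\<forall>m. s m \<noteq> f) \<and> converges_pointwise X s (h n)" for n
  proof -
    obtain s where s: "range s \<subseteq> S n" "converges_pointwise X s (h n)"
      using S[of n] h[of n] unfolding countable_seq_dense_families_iff by blast
    have "(\<lambda>m. s m x0) \<longlonglongrightarrow> h n x0"
      using s(2) x0 by (simp add: converges_pointwise_def)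
    moreover have "h n x0 \<noteq> f x0"
      using x0 by (simp add: h_def del: of_nat_Suc)
    ultimately have "\<forall>\<^sub>F m in sequentially. s m x0 \<noteq> f x0"
      by (rule tendsto_imp_eventually_ne)
    then obtain N where N: "\<And>m. m \<ge> N \<Longrightarrow> s m x0 \<noteq> f x0"
      unfolding eventually_sequentially by blast
    have "converges_pointwise X (\<lambda>m. s (m + N)) (h n)"
      using s(2) by (rule converges_pointwise_subseq) (rule filterlim_add_const_nat_at_top)
    moreover have "s (m + N) \<noteq> f" for m
      using N[of "m + N"] by auto
    ultimately show ?thesis
      using s(1) by (intro exI[of _ "\<lambda>m. s (m + N)"]) auto
  qed
  then obtain s where s: "\<And>n. range (s n) \<subseteq> S n" "\<And>n m. s n m \<noteq> f"
      "\<And>n. converges_pointwise X (s n) (h n)"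
    by metis
  have s_baire: "s n m \<in> baire_functions X" for n m
    using s(1)[of n] S[of n] unfolding countable_seq_dense_families_iff by blast
  have "converges_pointwise X h f"
    unfolding converges_pointwise_def
  proof
    fix x
    assume "x \<in> topspace X"
    then show "(\<lambda>n. h n x) \<longlonglongrightarrow> f x"
      using tendsto_add[OF tendsto_const LIMSEQ_inverse_real_of_nat, of "f x"]
      by (simp add: h_def)
  qed
  then obtain m where m: "converges_pointwise X (\<lambda>n. s n (m n)) f"
    using diagonal_limit[OF diag, of s h f, OF s_baire h s(3)] by blast
  show thesis
    using that[of "\<lambda>n. s n (m n)"] s m by blast
qed

lemma diagonal_imp_S_one_gamma_gamma:
  assumes diag: "baire_diagonal X" and f: "f \<in> baire_functions X"
  shows "S_one (gamma_families_at X f) (gamma_families_at X f)"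
  unfolding S_one_def
proof (intro allI impI)
  fix A :: "nat \<Rightarrow> ('a \<Rightarrow> real) set"
  assume A: "\<forall>n. A n \<in> gamma_families_at X f"
  then have A': "A n \<subseteq> baire_functions X" "countable (A n)" "infinite (A n)" "f \<notin> A n" for n
    by (auto simp: gamma_families_at_def)
  have s: "bij_betw (from_nat_into (A n)) UNIV (A n)" for n
    using A'(2,3) by (rule bij_betw_from_nat_into)
  have s_in: "from_nat_into (A n) m \<in> A n" for n m
    using s[of n] by (auto simp: bij_betw_def)
  have "converges_pointwise X (from_nat_into (A n)) f" for n
    using A f s[of n] by (intro gamma_family_converges[of "A n"]) (auto simp: bij_betw_def)
  moreover have "from_nat_into (A n) m \<in> baire_functions X" for n m
    using A'(1) s_in by blast
  moreover have "converges_pointwise X (\<lambda>_. f) f"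
    by (simp add: converges_pointwise_def)
  ultimately obtain m where m: "converges_pointwise X (\<lambda>n. from_nat_into (A n) (m n)) f"
    using diagonal_limit[OF diag, of "\<lambda>n. from_nat_into (A n)" "\<lambda>_. f" f] f by blast
  have "range (\<lambda>n. from_nat_into (A n) (m n)) \<in> gamma_families_at X f"
  proof (rule range_gamma_family)
    show "from_nat_into (A n) (m n) \<noteq> f" for n
      using A'(4) s_in[of n "m n"] by metis
  qed (use A'(1) s_in f m in blast)+
  then show "\<exists>b. (\<forall>n. b n \<in> A n) \<and> range b \<in> gamma_families_at X f"
    using s_in by (intro exI[of _ "\<lambda>n. from_nat_into (A n) (m n)"]) simp
qed

lemma diagonal_imp_S_one_dense_gamma:
  assumes "baire_diagonal X" "topspace X \<noteq> {}" "f \<in> baire_functions X"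
  shows "S_one (countable_seq_dense_families X) (gamma_families_at X f)"
  unfolding S_one_def
proof (intro allI impI)
  fix S :: "nat \<Rightarrow> ('a \<Rightarrow> real) set"
  assume S: "\<forall>n. S n \<in> countable_seq_dense_families X"
  then obtain b where b: "\<And>n. b n \<in> S n" "\<And>n. b n \<noteq> f" "converges_pointwise X b f"
    using diagonal_selection_from_dense[of X S f] assms by blast
  have "b n \<in> baire_functions X" for n
    using S b(1) unfolding countable_seq_dense_families_iff by blast
  then have "range b \<in> gamma_families_at X f"
    using b assms(3) by (intro range_gamma_family)
  then show "\<exists>b. (\<forall>n. b n \<in> S n) \<and> range b \<in> gamma_families_at X f"
    using b(1) by blast
qed

text \<open>The index set is split into infinitely many infinite parts, and the terms chosen on the
  \<open>j\<close>-th part converge to the \<open>j\<close>-th element of a countable sequentially dense set. One further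
  diagonal step reaches an arbitrary function.\<close>

lemma diagonal_imp_S_one_dense_dense:
  assumes diag: "baire_diagonal X" and ne: "topspace X \<noteq> {}"
  shows "S_one (countable_seq_dense_families X) (countable_seq_dense_families X)"
  unfolding S_one_def
proof (intro allI impI)
  fix S :: "nat \<Rightarrow> ('a \<Rightarrow> real) set"
  assume S: "\<forall>n. S n \<in> countable_seq_dense_families X"
  then have S_baire: "S n \<subseteq> baire_functions X" for n
    unfolding countable_seq_dense_families_iff by blast
  have D: "countable (S 0)" "S 0 \<subseteq> baire_functions X"
      "\<And>f. f \<in> baire_functions X \<Longrightarrow> \<exists>s. range s \<subseteq> S 0 \<and> converges_pointwise X s f"
    using S unfolding countable_seq_dense_families_iff by blast+
  have "S 0 \<noteq> {}"
    using D(3) baire_functions_nonempty[of X] by fastforce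
  define d where "d = from_nat_into (S 0)"
  have d: "range d = S 0"
    using D(1) \<open>S 0 \<noteq> {}\<close> by (simp add: d_def)
  have d_baire: "d j \<in> baire_functions X" for j
    using d D(2) by blast
  have "\<forall>j. \<exists>c. (\<forall>i. c i \<in> S (prod_encode (j, i))) \<and> converges_pointwise X c (d j)"
  proof
    fix j
    have "\<forall>i. S (prod_encode (j, i)) \<in> countable_seq_dense_families X"
      using S by simp
    from diagonal_selection_from_dense[OF diag ne, of "\<lambda>i. S (prod_encode (j, i))" "d j",
        OF spec[OF this] d_baire]
    obtain c where "\<And>i. c i \<in> S (prod_encode (j, i))" "converges_pointwise X c (d j)"
      by metis
    then show "\<exists>c. (\<forall>i. c i \<in> S (prod_encode (j, i))) \<and> converges_pointwise X c (d j)"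
      by (intro exI[of _ c]) simp
  qed
  then obtain c where c: "\<And>j i. c j i \<in> S (prod_encode (j, i))"
      "\<And>j. converges_pointwise X (c j) (d j)"
    by (auto dest!: choice)
  define b where "b n = (case prod_decode n of (j, i) \<Rightarrow> c j i)" for n
  have b_S: "b n \<in> S n" for n
    using c(1)[of "fst (prod_decode n)" "snd (prod_decode n)"]
    by (simp add: b_def case_prod_beta)
  have c_b: "c j i \<in> range b" for j i
    by (rule image_eqI[of _ _ "prod_encode (j, i)"]) (simp_all add: b_def)
  have c_baire: "c j i \<in> baire_functions X" for j i
    using c(1) S_baire by blast
  have "range b \<in> countable_seq_dense_families X"
    unfolding countable_seq_dense_families_iff
  proof (intro conjI ballI)
    show "range b \<subseteq> baire_functions X"
      using b_S S_baire by blast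
    fix f
    assume "f \<in> baire_functions X"
    then obtain s where s: "range s \<subseteq> S 0" "converges_pointwise X s f"
      using D(3) by blast
    then have "\<forall>k. \<exists>j. s k = d j"
      using d by blast
    then obtain j where j: "\<And>k. s k = d (j k)"
      by (auto dest!: choice)
    then have "converges_pointwise X (\<lambda>k. d (j k)) f"
      using s(2) by (simp add: converges_pointwise_def)
    then obtain m where "converges_pointwise X (\<lambda>k. c (j k) (m k)) f"
      using diagonal_limit[OF diag, of "\<lambda>k. c (j k)" "\<lambda>k. d (j k)" f, OF c_baire d_baire c(2)]
      by blast
    then show "\<exists>s. range s \<subseteq> range b \<and> converges_pointwise X s f"
      using c_b by (intro exI[of _ "\<lambda>k. c (j k) (m k)"]) auto
  qed simp
  then show "\<exists>b. (\<forall>n. b n \<in> S n) \<and> range b \<in> countable_seq_dense_families X"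
    using b_S by blast
qed

text \<open>The \<open>n\<close>-th finite set collects the \<open>n\<close>-th terms of sequences that converge to the first
  \<open>n+1\<close> elements of a countable sequentially dense set. Some element of that set is close to
  a given function at a given point, and from its index on it is approximated there.\<close>

lemma diagonal_imp_U_fin_dense_dense:
  assumes diag: "baire_diagonal X" and ne: "topspace X \<noteq> {}"
  shows "U_fin_dense_dense X"
  unfolding U_fin_dense_dense_def
proof (intro allI impI)
  fix S :: "nat \<Rightarrow> ('a \<Rightarrow> real) set"
  assume S: "\<forall>n. S n \<in> countable_seq_dense_families X"
  have D: "countable (S 0)" "S 0 \<subseteq> baire_functions X"
      "\<And>f. f \<in> baire_functions X \<Longrightarrow> \<exists>s. range s \<subseteq> S 0 \<and> converges_pointwise X s f"
    using S unfolding countable_seq_dense_families_iff by blast+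
  have "S 0 \<noteq> {}"
    using D(3) baire_functions_nonempty[of X] by fastforce
  define d where "d = from_nat_into (S 0)"
  have d: "range d = S 0"
    using D(1) \<open>S 0 \<noteq> {}\<close> by (simp add: d_def)
  have "\<forall>j. \<exists>c. (\<forall>n. c n \<in> S n) \<and> converges_pointwise X c (d j)"
  proof
    fix j
    have "d j \<in> baire_functions X"
      using d D(2) by blast
    from diagonal_selection_from_dense[OF diag ne, of S "d j", OF spec[OF S] this]
    obtain c where "\<And>n. c n \<in> S n" "converges_pointwise X c (d j)"
      by metis
    then show "\<exists>c. (\<forall>n. c n \<in> S n) \<and> converges_pointwise X c (d j)"
      by (intro exI[of _ c]) simp
  qed
  then obtain c where c: "\<And>j n. c j n \<in> S n" "\<And>j. converges_pointwise X (c j) (d j)"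
    by (auto dest!: choice)
  define F where "F n = (\<lambda>j. c j n) ` {..n}" for n
  have "eventually_approximates X F f" if f: "f \<in> baire_functions X" for f
    unfolding eventually_approximates_iff
  proof (intro ballI allI impI)
    fix x and e :: real
    assume x: "x \<in> topspace X" and e: "e > 0"
    obtain s where s: "range s \<subseteq> S 0" "converges_pointwise X s f"
      using D(3)[OF f] by blast
    then have "(\<lambda>k. s k x) \<longlonglongrightarrow> f x"
      using x by (simp add: converges_pointwise_def)
    then have "\<forall>\<^sub>F k in sequentially. dist (s k x) (f x) < e / 2"
      using e by (intro tendstoD) auto
    then obtain k where k: "dist (s k x) (f x) < e / 2"
      by (auto dest: eventually_happens)
    obtain j where j: "s k = d j"
      using s(1) d by blast
    have "(\<lambda>n. c j n x) \<longlonglongrightarrow> d j x"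
      using c(2) x by (simp add: converges_pointwise_def)
    then have "\<forall>\<^sub>F n in sequentially. dist (c j n x) (d j x) < e / 2"
      using e by (intro tendstoD) auto
    then show "\<forall>\<^sub>F n in sequentially. \<exists>g\<in>F n. \<bar>g x - f x\<bar> < e"
      using eventually_ge_at_top[of j]
    proof eventually_elim
      case (elim n)
      have "\<bar>c j n x - f x\<bar> < e"
        using elim(1) k j by (simp add: dist_real_def abs_if split: if_splits)
      moreover have "c j n \<in> F n"
        using elim(2) by (simp add: F_def)
      ultimately show ?case
        by blast
    qed
  qed
  moreover have "finite (F n) \<and> F n \<subseteq> S n" for n
    using c(1) by (auto simp: F_def)
  ultimately show "\<exists>F. (\<forall>n. finite (F n) \<and> F n \<subseteq> S n) \<and>
      (\<forall>f\<in>baire_functions X. eventually_approximates X F f)"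
    by blast
qed

lemma S_one_imp_S_fin:
  assumes "S_one P Q"
  shows "S_fin P Q"
  unfolding S_fin_def
proof (intro allI impI)
  fix A :: "nat \<Rightarrow> 'a set"
  assume "\<forall>n. A n \<in> P"
  then have "\<exists>b. (\<forall>n. b n \<in> A n) \<and> range b \<in> Q"
    using assms[unfolded S_one_def, rule_format, of A] by simp
  then obtain b where b: "\<forall>n. b n \<in> A n" "range b \<in> Q"
    by (elim exE conjE)
  moreover have "(\<Union>n. {b n}) = range b"
    by blast
  ultimately show "\<exists>B. (\<forall>n. finite (B n) \<and> B n \<subseteq> A n) \<and> (\<Union>n. B n) \<in> Q"
    by (intro exI[of _ "\<lambda>n. {b n}"]) simp
qed

lemma U_fin_dense_dense_imp_gamma:
  assumes "U_fin_dense_dense X" "f \<in> baire_functions X"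
  shows "U_fin_dense_gamma X f"
  using assms unfolding U_fin_dense_dense_def U_fin_dense_gamma_def by meson


section \<open>From the selection principles to the diagonal property\<close>

text \<open>This is implied by each of the selection principles. Approximation is asked only along a
  sequence of indices that tends to infinity, as the selected functions may converge only
  along such a sequence, and only for functions outside the given sets, as otherwise a
  selection could be constant.\<close>

definition dense_approximation :: "'a topology \<Rightarrow> bool" where
  "dense_approximation X \<longleftrightarrow>
     (\<forall>S f. (\<forall>n::nat. S n \<in> countable_seq_dense_families X) \<and> f \<in> baire_functions X \<and>
        (\<forall>n. f \<notin> S n) \<longrightarrow>
        (\<exists>F r. (\<forall>n. finite (F n) \<and> F n \<subseteq> S n) \<and> filterlim r at_top sequentially \<and>
           eventually_approximates X (\<lambda>i. F (r i)) f))"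

text \<open>A sequence that converges to \<open>f\<close> without taking the value \<open>f\<close> takes each value only finitely
  often, so it cannot stay in finitely many of the finite sets \<open>F n\<close>.\<close>

lemma convergent_selection_approximates:
  fixes F :: "nat \<Rightarrow> ('a \<Rightarrow> real) set"
  assumes F: "\<And>n. finite (F n)" "\<And>n. F n \<subseteq> baire_functions X" "\<And>n. f \<notin> F n"
    and f: "f \<in> baire_functions X"
    and s: "range s \<subseteq> (\<Union>n. F n)" "converges_pointwise X s f"
  shows "\<exists>r. filterlim r at_top sequentially \<and> eventually_approximates X (\<lambda>i. F (r i)) f"
proof -
  have "\<forall>i. \<exists>n. s i \<in> F n"
    using s(1) by blast
  then obtain r where r: "\<And>i. s i \<in> F (r i)"
    by (auto dest!: choice)
  have fin: "finite {i. r i \<le> N}" for N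
  proof (rule ccontr)
    assume inf: "infinite {i. r i \<le> N}"
    have "s ` {i. r i \<le> N} \<subseteq> (\<Union>n\<le>N. F n)"
      using r by auto
    then have "finite (s ` {i. r i \<le> N})"
      by (rule finite_subset) (intro finite_UN_I finite_atMost F(1))
    then obtain k where k: "infinite {i \<in> {i. r i \<le> N}. s i = s k}"
      using pigeonhole_infinite[OF inf] by blast
    have "infinite {i. s i = s k}"
      using k by (rule infinite_super[rotated]) auto
    then have freq: "\<exists>\<^sub>F i in sequentially. s i = s k"
      by (simp add: cofinite_eq_sequentially[symmetric] frequently_cofinite)
    have "s k = f"
      using recurrent_value_eq_limit[OF _ f s(2) freq] r F(2) by blast
    then show False
      using r F(3) by metis
  qed
  have "finite {i. \<not> N \<le> r i}" for N
    by (rule finite_subset[OF _ fin[of N]]) auto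
  then have "filterlim r at_top cofinite"
    unfolding filterlim_at_top eventually_cofinite by blast
  then have "filterlim r at_top sequentially"
    by (simp only: cofinite_eq_sequentially)
  moreover have "eventually_approximates X (\<lambda>i. F (r i)) f"
    by (rule converges_imp_eventually_approximates[OF s(2) r])
  ultimately show ?thesis
    by blast
qed

lemma S_fin_dense_dense_imp_dense_approximation:
  assumes "S_fin (countable_seq_dense_families X) (countable_seq_dense_families X)"
  shows "dense_approximation X"
  unfolding dense_approximation_def
proof (intro allI impI, elim conjE)
  fix S :: "nat \<Rightarrow> ('a \<Rightarrow> real) set" and f
  assume S: "\<forall>n. S n \<in> countable_seq_dense_families X" and f: "f \<in> baire_functions X" "\<forall>n. f \<notin> S n"
  obtain F where F: "\<forall>n. finite (F n) \<and> F n \<subseteq> S n" "(\<Union>n. F n) \<in> countable_seq_dense_families X"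
    using assms S unfolding S_fin_def by blast
  obtain s where "range s \<subseteq> (\<Union>n. F n)" "converges_pointwise X s f"
    using F(2) f(1) unfolding countable_seq_dense_families_iff by blast
  moreover have "F n \<subseteq> baire_functions X" for n
    using F S unfolding countable_seq_dense_families_iff by blast
  moreover have "f \<notin> F n" for n
    using F f by blast
  ultimately show "\<exists>F r. (\<forall>n. finite (F n) \<and> F n \<subseteq> S n) \<and> filterlim r at_top sequentially \<and>
      eventually_approximates X (\<lambda>i. F (r i)) f"
    using convergent_selection_approximates[of F X f s] F f(1) by blast
qed

lemma S_fin_dense_gamma_imp_dense_approximation:
  assumes "\<And>f. f \<in> baire_functions X \<Longrightarrow>
    S_fin (countable_seq_dense_families X) (gamma_families_at X f)"
  shows "dense_approximation X"
  unfolding dense_approximation_def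
proof (intro allI impI, elim conjE)
  fix S :: "nat \<Rightarrow> ('a \<Rightarrow> real) set" and f
  assume S: "\<forall>n. S n \<in> countable_seq_dense_families X" and f: "f \<in> baire_functions X" "\<forall>n. f \<notin> S n"
  obtain F where F: "\<forall>n. finite (F n) \<and> F n \<subseteq> S n" "(\<Union>n. F n) \<in> gamma_families_at X f"
    using assms[OF f(1)] S unfolding S_fin_def by blast
  define s where "s = from_nat_into (\<Union>n. F n)"
  have "bij_betw s UNIV (\<Union>n. F n)"
    unfolding s_def using F(2) by (intro bij_betw_from_nat_into) (simp_all add: gamma_families_at_def)
  then have "inj s" "range s \<subseteq> (\<Union>n. F n)"
    by (auto simp: bij_betw_def)
  moreover have "converges_pointwise X s f"
    by (rule gamma_family_converges[OF F(2) f(1)]) fact+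
  moreover have "F n \<subseteq> baire_functions X" for n
    using F S unfolding countable_seq_dense_families_iff by blast
  moreover have "f \<notin> F n" for n
    using F f by blast
  ultimately show "\<exists>F r. (\<forall>n. finite (F n) \<and> F n \<subseteq> S n) \<and> filterlim r at_top sequentially \<and>
      eventually_approximates X (\<lambda>i. F (r i)) f"
    using convergent_selection_approximates[of F X f s] F f(1) by blast
qed

text \<open>A sequence in \<open>S n\<close> that converges to a function outside \<open>S n\<close> has an infinite range, so it
  provides an element of \<^term>\<open>gamma_families_at X f\<close> that consists of members of \<open>S n\<close>.\<close>

lemma S_one_gamma_gamma_imp_dense_approximation:
  assumes "\<And>f. f \<in> baire_functions X \<Longrightarrow> S_one (gamma_families_at X f) (gamma_families_at X f)"
  shows "dense_approximation X"
  unfolding dense_approximation_def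
proof (intro allI impI, elim conjE)
  fix S :: "nat \<Rightarrow> ('a \<Rightarrow> real) set" and f
  assume S: "\<forall>n. S n \<in> countable_seq_dense_families X" and f: "f \<in> baire_functions X" "\<forall>n. f \<notin> S n"
  have S_baire: "S n \<subseteq> baire_functions X" for n
    using S unfolding countable_seq_dense_families_iff by blast
  have "\<forall>n. \<exists>s. range s \<subseteq> S n \<and> converges_pointwise X s f"
    using S f unfolding countable_seq_dense_families_iff by blast
  then obtain s where s: "\<And>n. range (s n) \<subseteq> S n" "\<And>n. converges_pointwise X (s n) f"
    by (auto dest!: choice)
  have "range (s n) \<in> gamma_families_at X f" for n
  proof (rule range_gamma_family)
    show "s n m \<noteq> f" for m
      using f(2) s(1) by blast
  qed (use s S_baire f in blast)+
  then have "\<exists>b. (\<forall>n. b n \<in> range (s n)) \<and> range b \<in> gamma_families_at X f"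
    using assms[OF f(1)] unfolding S_one_def by simp
  then obtain b where b: "\<And>n. b n \<in> range (s n)" "range b \<in> gamma_families_at X f"
    by blast
  define t where "t = from_nat_into (range b)"
  have "bij_betw t UNIV (range b)"
    unfolding t_def using b(2) by (intro bij_betw_from_nat_into) (simp_all add: gamma_families_at_def)
  then have t: "inj t" "range t \<subseteq> range b"
    by (auto simp: bij_betw_def)
  have b_S: "b n \<in> S n" for n
    using b(1) s(1) by blast
  have "\<exists>r. filterlim r at_top sequentially \<and> eventually_approximates X (\<lambda>i. {b (r i)}) f"
  proof (rule convergent_selection_approximates)
    show "converges_pointwise X t f"
      by (rule gamma_family_converges[OF b(2) f(1) t])
    show "f \<notin> {b n}" for n
      using b_S[of n] f(2) by auto
  qed (use t b_S S_baire f in auto)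
  then obtain r where "filterlim r at_top sequentially"
      "eventually_approximates X (\<lambda>i. {b (r i)}) f"
    by blast
  then show "\<exists>F r. (\<forall>n. finite (F n) \<and> F n \<subseteq> S n) \<and> filterlim r at_top sequentially \<and>
      eventually_approximates X (\<lambda>i. F (r i)) f"
    using b_S by (intro exI[of _ "\<lambda>n. {b n}"] exI[of _ r]) simp
qed

lemma U_fin_dense_gamma_imp_dense_approximation:
  assumes "\<And>f. f \<in> baire_functions X \<Longrightarrow> U_fin_dense_gamma X f"
  shows "dense_approximation X"
  unfolding dense_approximation_def
proof (intro allI impI, elim conjE)
  fix S :: "nat \<Rightarrow> ('a \<Rightarrow> real) set" and f
  assume "\<forall>n. S n \<in> countable_seq_dense_families X" "f \<in> baire_functions X"
  then obtain F where "\<forall>n. finite (F n) \<and> F n \<subseteq> S n" "eventually_approximates X F f"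
    using assms unfolding U_fin_dense_gamma_def by blast
  then show "\<exists>F r. (\<forall>n. finite (F n) \<and> F n \<subseteq> S n) \<and> filterlim r at_top sequentially \<and>
      eventually_approximates X (\<lambda>i. F (r i)) f"
    by (intro exI[of _ F] exI[of _ "\<lambda>n. n"]) (simp add: filterlim_ident)
qed

text \<open>If each set of a sequence \<open>V 0 \<subseteq> V 1 \<subseteq> \<dots>\<close> is Baire and the union is everything,
  then replacing the \<open>m\<close>-th function of a sequentially dense sequence by \<open>1\<close> outside \<open>V m\<close> keeps
  the sequence sequentially dense, provided that each function is listed infinitely often. The
  altered \<open>m\<close>-th function can come close to a constant \<open>c \<noteq> 1\<close> only at points of \<open>V m\<close>, so finitely
  many of these functions that approximate \<open>c\<close> at a point tell an index \<open>m\<close> for which the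
  point belongs to \<open>V m\<close>.\<close>

lemma dense_approximation_imp_baire_index_selection:
  assumes appr: "dense_approximation X" and ne: "topspace X \<noteq> {}"
    and sep: "sequentially_separable_space (baire_function_space X)"
  shows "baire_index_selection X"
  unfolding baire_index_selection_def
proof (intro allI impI, elim conjE)
  fix U :: "nat \<Rightarrow> nat \<Rightarrow> 'a set"
  assume U: "\<forall>k m. U k m \<in> baire_sets X"
    and ev: "\<forall>k. \<forall>x\<in>topspace X. \<forall>\<^sub>F m in sequentially. x \<in> U k m"
  define V where "V k m = {x \<in> topspace X. \<forall>i\<le>k. \<forall>m'\<ge>m. x \<in> U i m'}" for k m
  have V_mono: "V k m \<subseteq> V k' m'" if "k' \<le> k" "m \<le> m'" for k k' m m'
    using that by (auto simp: V_def)
  have V_U: "V k m \<subseteq> U k' m" if "k' \<le> k" for k k' m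
    using that by (auto simp: V_def)
  have V_baire: "V k m \<in> sets (baire_measurable_space X)" for k m
  proof -
    have [measurable]: "U i m' \<in> sets (baire_measurable_space X)" for i m'
      using U by (simp add: sets_baire_measurable_space)
    have "{x \<in> space (baire_measurable_space X). \<forall>i\<le>k. \<forall>m'\<ge>m. x \<in> U i m'}
        \<in> sets (baire_measurable_space X)"
      by measurable
    then show ?thesis
      by (simp only: V_def space_baire_measurable_space)
  qed
  have V_ev: "\<forall>\<^sub>F m in sequentially. x \<in> V k m" if x: "x \<in> topspace X" for k x
  proof -
    have "\<forall>\<^sub>F m in sequentially. \<forall>i\<in>{..k}. x \<in> U i m"
      using ev x by (intro eventually_ball_finite) auto
    then obtain N where "\<And>m i. m \<ge> N \<Longrightarrow> i \<le> k \<Longrightarrow> x \<in> U i m"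
      unfolding eventually_sequentially by auto
    then show ?thesis
      using x unfolding eventually_sequentially V_def by (intro exI[of _ N]) auto
  qed
  obtain D where "D \<in> countable_seq_dense_families X"
    using sep by (auto simp: sequentially_separable_iff)
  then have D: "countable D" "D \<subseteq> baire_functions X"
      "\<And>f. f \<in> baire_functions X \<Longrightarrow> \<exists>s. range s \<subseteq> D \<and> converges_pointwise X s f"
    by (auto simp: countable_seq_dense_families_iff)
  have "D \<noteq> {}"
    using D(3) baire_functions_nonempty[of X] by fastforce
  \<comment> \<open>Each element of \<open>D\<close> occurs at infinitely many positions of this enumeration.\<close>
  define d where "d m = from_nat_into D (fst (prod_decode m))" for m
  have d_D: "d m \<in> D" for m
    unfolding d_def using \<open>D \<noteq> {}\<close> by (rule from_nat_into)
  define d' where "d' k m = (\<lambda>x\<in>topspace X. if x \<in> V k m then d m x else 1)" for k m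
  have d'_baire: "d' k m \<in> baire_functions X" for k m
  proof -
    have [measurable]: "V k m \<in> sets (baire_measurable_space X)"
        "d m \<in> borel_measurable (baire_measurable_space X)"
      by (fact V_baire, rule baire_functions_measurable, use d_D D(2) in blast)
    show ?thesis
      unfolding d'_def restrict_in_baire_functions_iff by measurable
  qed
  define S where "S k = range (d' k)" for k
  have S: "S k \<in> countable_seq_dense_families X" for k
    unfolding countable_seq_dense_families_iff
  proof (intro conjI ballI)
    fix f
    assume "f \<in> baire_functions X"
    then obtain s where s: "range s \<subseteq> D" "converges_pointwise X s f"
      using D(3) by blast
    define p where "p i = prod_encode (to_nat_on D (s i), i)" for i
    have d_p: "d (p i) = s i" for i
      using s(1) from_nat_into_to_nat_on[OF D(1), of "s i"] by (auto simp: d_def p_def)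
    have p: "filterlim p at_top sequentially"
      by (rule filterlim_at_top_mono[OF filterlim_ident])
        (simp add: p_def le_prod_encode_2)
    have "(\<lambda>i. d' k (p i) x) \<longlonglongrightarrow> f x" if x: "x \<in> topspace X" for x
    proof (rule Lim_transform_eventually)
      show "(\<lambda>i. s i x) \<longlonglongrightarrow> f x"
        using s(2) x by (simp add: converges_pointwise_def)
      have "\<forall>\<^sub>F i in sequentially. x \<in> V k (p i)"
        using V_ev[OF x] p by (rule eventually_compose_filterlim)
      then show "\<forall>\<^sub>F i in sequentially. s i x = d' k (p i) x"
        by eventually_elim (simp add: d'_def d_p x)
    qed
    then show "\<exists>s. range s \<subseteq> S k \<and> converges_pointwise X s f"
      unfolding S_def converges_pointwise_def by (intro exI[of _ "\<lambda>i. d' k (p i)"]) auto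
  qed (use d'_baire in \<open>auto simp: S_def\<close>)
  define const where "const c = (\<lambda>x\<in>topspace X. c)" for c :: real
  \<comment> \<open>Only countably many constants belong to some \<open>S k\<close>.\<close>
  have "\<exists>c. c \<noteq> 1 \<and> (\<forall>k. const c \<notin> S k)"
  proof (rule ccontr)
    assume "\<nexists>c. c \<noteq> 1 \<and> (\<forall>k. const c \<notin> S k)"
    then have "const ` (UNIV - {1}) \<subseteq> (\<Union>k. S k)"
      by auto
    moreover have "countable (\<Union>k. S k)"
      by (simp add: S_def)
    ultimately have "countable (const ` (UNIV - {1}))"
      by (rule countable_subset)
    moreover have "inj const"
    proof (rule injI)
      fix c c' :: real
      assume eq: "const c = const c'"
      obtain x where "x \<in> topspace X"
        using ne by blast
      then show "c = c'"
        using fun_cong[OF eq, of x] by (simp add: const_def)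
    qed
    ultimately have "countable (UNIV - {1::real})"
      using inj_on_subset countable_image_inj_on by (metis subset_UNIV)
    then show False
      using uncountable_UNIV_real countable_insert[of "UNIV - {1::real}" 1]
      by (simp add: insert_absorb)
  qed
  then obtain c where c: "c \<noteq> 1" "\<And>k. const c \<notin> S k"
    by blast
  have "const c \<in> baire_functions X"
    unfolding const_def by (intro restrict_continuous_in_baire_functions) simp
  then have "\<exists>F r. (\<forall>n. finite (F n) \<and> F n \<subseteq> S n) \<and> filterlim r at_top sequentially \<and>
      eventually_approximates X (\<lambda>i. F (r i)) (const c)"
    using appr S c(2) unfolding dense_approximation_def by simp
  then obtain F r where F: "\<And>n. finite (F n)" "\<And>n. F n \<subseteq> S n"
    and r: "filterlim r at_top sequentially"
    and F_appr: "eventually_approximates X (\<lambda>i. F (r i)) (const c)"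
    by blast
  have "\<forall>n. \<exists>N. F n \<subseteq> d' n ` {..N}"
  proof
    fix n
    obtain I where I: "finite I" "F n = d' n ` I"
      using finite_subset_image[OF F(1)[of n], of "d' n" UNIV] F(2)[of n] by (auto simp: S_def)
    then obtain N where "I \<subseteq> {..N}"
      using finite_nat_iff_bounded_le by blast
    then show "\<exists>N. F n \<subseteq> d' n ` {..N}"
      using I(2) by blast
  qed
  then obtain N where N: "\<And>n. F n \<subseteq> d' n ` {..N n}"
    by (auto dest!: choice)
  have in_V: "\<forall>\<^sub>F i in sequentially. x \<in> V (r i) (N (r i))" if x: "x \<in> topspace X" for x
  proof -
    have "\<forall>\<^sub>F i in sequentially. \<exists>g\<in>F (r i). \<bar>g x - const c x\<bar> < \<bar>1 - c\<bar>"
      using F_appr x c(1) unfolding eventually_approximates_iff by simp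
    then show ?thesis
    proof eventually_elim
      case (elim i)
      then obtain m where m: "m \<le> N (r i)" "\<bar>d' (r i) m x - c\<bar> < \<bar>1 - c\<bar>"
        using N[of "r i"] x by (auto simp: const_def)
      then have "x \<in> V (r i) m"
        using x by (auto simp: d'_def split: if_splits)
      then show ?case
        using V_mono[of "r i" "r i" m "N (r i)"] m(1) by auto
    qed
  qed
  have "\<forall>k. \<exists>i\<ge>k. k \<le> r i"
  proof
    fix k
    have "\<forall>\<^sub>F i in sequentially. k \<le> r i"
      using r by (simp add: filterlim_at_top)
    then have "\<forall>\<^sub>F i in sequentially. k \<le> i \<and> k \<le> r i"
      using eventually_ge_at_top[of k] by eventually_elim simp
    then show "\<exists>i\<ge>k. k \<le> r i"
      by (auto dest: eventually_happens)
  qed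
  then obtain j where j: "\<And>k. k \<le> j k" "\<And>k. k \<le> r (j k)"
    by (auto dest!: choice)
  have "\<forall>\<^sub>F k in sequentially. x \<in> U k (N (r (j k)))" if x: "x \<in> topspace X" for x
  proof -
    have "filterlim j at_top sequentially"
      by (rule filterlim_at_top_mono[OF filterlim_ident]) (simp add: j(1))
    with in_V[OF x] have "\<forall>\<^sub>F k in sequentially. x \<in> V (r (j k)) (N (r (j k)))"
      by (rule eventually_compose_filterlim)
    then show ?thesis
      by eventually_elim (use V_U j(2) in blast)
  qed
  then show "\<exists>m. \<forall>x\<in>topspace X. \<forall>\<^sub>F k in sequentially. x \<in> U k (m k)"
    by (intro exI[of _ "\<lambda>k. N (r (j k))"]) simp
qed


section \<open>The equivalences\<close>

theorem theorem7p2: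
  fixes X :: "'a topology"
  assumes "tychonoff_space X" and "topspace X \<noteq> {}"
  shows "all_equivalent
    [sequentially_separable_space (baire_function_space X) \<and>
       S_one (countable_seq_dense_families X) (countable_seq_dense_families X),
     S_one (baire_gamma_covers X) (baire_gamma_covers X) \<and> O_property X,
     sequentially_separable_space (baire_function_space X) \<and>
       (\<forall>f\<in>baire_functions X. S_one (gamma_families_at X f) (gamma_families_at X f)),
     sequentially_separable_space (baire_function_space X) \<and>
       (\<forall>f\<in>baire_functions X. S_one (countable_seq_dense_families X) (gamma_families_at X f)),
     sequentially_separable_space (baire_function_space X) \<and>
       S_fin (countable_seq_dense_families X) (countable_seq_dense_families X),
     sequentially_separable_space (baire_function_space X) \<and>
       U_fin_dense_dense X,
     sequentially_separable_space (baire_function_space X) \<and>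
       (\<forall>f\<in>baire_functions X. S_fin (countable_seq_dense_families X) (gamma_families_at X f)),
     sequentially_separable_space (baire_function_space X) \<and>
       (\<forall>f\<in>baire_functions X. U_fin_dense_gamma X f)]"
proof -
  let ?sep = "sequentially_separable_space (baire_function_space X)"
  let ?S = "countable_seq_dense_families X"
  have to_covers: "S_one (baire_gamma_covers X) (baire_gamma_covers X) \<and> O_property X"
    if "?sep" "dense_approximation X"
    using sequentially_separable_imp_O_property[OF assms(1) that(1)]
      baire_index_selection_imp_S_one[OF
        dense_approximation_imp_baire_index_selection[OF that(2) assms(2) that(1)]] by blast
  have from_covers: "?sep \<and> baire_diagonal X"
    if "S_one (baire_gamma_covers X) (baire_gamma_covers X) \<and> O_property X"
  proof -
    have "baire_diagonal X"
      using that by (intro baire_index_selection_imp_diagonal S_one_imp_baire_index_selection) blast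
    then show ?thesis
      using O_property_imp_sequentially_separable that by blast
  qed
  note diag = diagonal_imp_S_one_dense_dense[OF _ assms(2)] diagonal_imp_S_one_gamma_gamma
    diagonal_imp_S_one_dense_gamma[OF _ assms(2)] diagonal_imp_U_fin_dense_dense[OF _ assms(2)]
  have 1: "?sep \<and> S_one ?S ?S \<longleftrightarrow>
      S_one (baire_gamma_covers X) (baire_gamma_covers X) \<and> O_property X"
    using to_covers from_covers diag(1) S_one_imp_S_fin
      S_fin_dense_dense_imp_dense_approximation by blast
  have 3: "?sep \<and> (\<forall>f\<in>baire_functions X. S_one (gamma_families_at X f) (gamma_families_at X f)) \<longleftrightarrow>
      S_one (baire_gamma_covers X) (baire_gamma_covers X) \<and> O_property X"
    using to_covers from_covers diag(2) S_one_gamma_gamma_imp_dense_approximation by blast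
  have 4: "?sep \<and> (\<forall>f\<in>baire_functions X. S_one ?S (gamma_families_at X f)) \<longleftrightarrow>
      S_one (baire_gamma_covers X) (baire_gamma_covers X) \<and> O_property X"
    using to_covers from_covers diag(3) S_one_imp_S_fin
      S_fin_dense_gamma_imp_dense_approximation by blast
  have 5: "?sep \<and> S_fin ?S ?S \<longleftrightarrow>
      S_one (baire_gamma_covers X) (baire_gamma_covers X) \<and> O_property X"
    using to_covers from_covers diag(1) S_one_imp_S_fin
      S_fin_dense_dense_imp_dense_approximation by blast
  have 6: "?sep \<and> U_fin_dense_dense X \<longleftrightarrow>
      S_one (baire_gamma_covers X) (baire_gamma_covers X) \<and> O_property X"
    using to_covers from_covers diag(4) U_fin_dense_dense_imp_gamma
      U_fin_dense_gamma_imp_dense_approximation by blast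
  have 7: "?sep \<and> (\<forall>f\<in>baire_functions X. S_fin ?S (gamma_families_at X f)) \<longleftrightarrow>
      S_one (baire_gamma_covers X) (baire_gamma_covers X) \<and> O_property X"
    using to_covers from_covers diag(3) S_one_imp_S_fin
      S_fin_dense_gamma_imp_dense_approximation by blast
  have 8: "?sep \<and> (\<forall>f\<in>baire_functions X. U_fin_dense_gamma X f) \<longleftrightarrow>
      S_one (baire_gamma_covers X) (baire_gamma_covers X) \<and> O_property X"
    using to_covers from_covers diag(4) U_fin_dense_dense_imp_gamma
      U_fin_dense_gamma_imp_dense_approximation by blast
  show ?thesis
    unfolding all_equivalent_def 1 3 4 5 6 7 8 by simp
qed

end
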